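(* Let $T>0$. Suppose that the problem $$u_t=\Delta u+c(x,t)u^p \ \ (x\in\Omega,\ t>0),\qquad \frac{\partial u(x,t)}{\partial\nu}=\int_\Omega k(x,y,t)u^l(y,t)\,dy\ \ (x\in\partial\Omega,\ t>0),\qquad u(x,0)=u_0(x)\ \ (x\in\Omega)$$ has a solution in $Q_T$, where the initial datum $u_0$ is an arbitrary nonnegative one if $\min(p,l)\ge1$, and is positive (that is, $u_0(x)>0$ for all $x\in\overline\Omega$) if $\min(p,l)<1$. Then the solution of this problem is unique in $Q_T$.
   Context: Standing assumptions: $p>0$, $l>0$; $\Omega$ is a bounded domain in $\mathbb{R}^n$, $n\ge1$, with smooth boundary $\partial\Omega$, and $\nu$ is the unit outward normal on $\partial\Omega$; $c\in C^{\alpha}_{loc}(\overline\Omega\times[0,+\infty))$ for some $0<\alpha<1$ and $c(x,t)\ge0$; $k\in C(\partial\Omega\times\overline\Omega\times[0,+\infty))$ and $k(x,y,t)\ge0$; $u_0\in C^1(\overline\Omega)$, $u_0(x)\ge0$ in $\Omega$, and $\frac{\partial u_0(x)}{\partial\nu}=\int_\Omega k(x,y,0)u_0^l(y)\,dy$ on $\partial\Omega$. Notation: $Q_T=\Omega\times(0,T)$, $S_T=\partial\Omega\times(0,T)$, $\Gamma_T=S_T\cup\overline\Omega\times\{0\}$. Definition: a nonnegative function $u\in C^{2,1}(Q_T)\cap C^{1,0}(Q_T\cup\Gamma_T)$ is a supersolution of the problem in $Q_T$ if $u_t\ge\Delta u+c(x,t)u^p$ for $(x,t)\in Q_T$, $\frac{\partial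 u(x,t)}{\partial\nu}\ge\int_\Omega k(x,y,t)u^l(y,t)\,dy$ for $(x,t)\in S_T$, and $u(x,0)\ge u_0(x)$ for $x\in\Omega$. A function $u\in C^{2,1}(Q_T)\cap C^{1,0}(Q_T\cup\Gamma_T)$ is a subsolution in $Q_T$ if $u\ge0$ and it satisfies these three inequalities in the reverse order. A solution in $Q_T$ is a function that is both a subsolution and a supersolution in $Q_T$. *)

theory Defs
  imports "HOL-Analysis.Analysis"
begin

text \<open>
  Space is an arbitrary Euclidean space \<open>'a\<close>, and functions of \<open>(x, t)\<close> are curried.
  Derivatives on a set \<open>S\<close> are taken within \<open>S\<close>.  On an open set these are the usual ones; on the
  closure of a smooth bounded domain they are uniquely determined, because \<open>S\<close> contains an open
  cone at each of its points, and their continuity up to the boundary says the same as continuous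
  extendability of the derivatives from the interior.
\<close>

definition partial_deriv ::
    "'a::euclidean_space set \<Rightarrow> 'a \<Rightarrow> ('a \<Rightarrow> real) \<Rightarrow> 'a \<Rightarrow> real" where
  "partial_deriv S b f x = frechet_derivative f (at x within S) b"

definition gradient :: "'a::euclidean_space set \<Rightarrow> ('a \<Rightarrow> real) \<Rightarrow> 'a \<Rightarrow> 'a" where
  "gradient S f x = (\<Sum>b\<in>Basis. partial_deriv S b f x *\<^sub>R b)"

definition laplacian :: "'a::euclidean_space set \<Rightarrow> ('a \<Rightarrow> real) \<Rightarrow> 'a \<Rightarrow> real" where
  "laplacian S f x = (\<Sum>b\<in>Basis. partial_deriv S b (partial_deriv S b f) x)"

primrec Ck_on :: "nat \<Rightarrow> ('a::euclidean_space \<Rightarrow> real) \<Rightarrow> 'a set \<Rightarrow> bool" where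
  "Ck_on 0 f S \<longleftrightarrow> continuous_on S f"
| "Ck_on (Suc m) f S \<longleftrightarrow>
     f differentiable_on S \<and> (\<forall>b\<in>Basis. Ck_on m (partial_deriv S b f) S)"

definition local_defining_function ::
    "'a::euclidean_space set \<Rightarrow> 'a \<Rightarrow> 'a set \<Rightarrow> ('a \<Rightarrow> real) \<Rightarrow> bool" where
  "local_defining_function \<Omega> x U \<phi> \<longleftrightarrow>
     open U \<and> x \<in> U \<and> (\<forall>m. Ck_on m \<phi> U) \<and>
     (\<forall>y\<in>U. gradient U \<phi> y \<noteq> 0) \<and>
     (\<forall>y\<in>U. y \<in> \<Omega> \<longleftrightarrow> \<phi> y < 0) \<and>
     (\<forall>y\<in>U. y \<in> frontier \<Omega> \<longleftrightarrow> \<phi> y = 0)"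

definition smooth_bounded_domain :: "'a::euclidean_space set \<Rightarrow> bool" where
  "smooth_bounded_domain \<Omega> \<longleftrightarrow>
     open \<Omega> \<and> connected \<Omega> \<and> \<Omega> \<noteq> {} \<and> bounded \<Omega> \<and>
     (\<forall>x\<in>frontier \<Omega>. \<exists>U \<phi>. local_defining_function \<Omega> x U \<phi>)"

text \<open>The gradient of a defining function that is negative inside \<open>\<Omega>\<close> points out of \<open>\<Omega>\<close>.\<close>

definition unit_outward_normal_at :: "'a::euclidean_space set \<Rightarrow> 'a \<Rightarrow> 'a \<Rightarrow> bool" where
  "unit_outward_normal_at \<Omega> x n \<longleftrightarrow>
     (\<exists>U \<phi>. local_defining_function \<Omega> x U \<phi> \<and>
            n = gradient U \<phi> x /\<^sub>R norm (gradient U \<phi> x))"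

definition normal_deriv ::
    "'a::euclidean_space set \<Rightarrow> ('a \<Rightarrow> 'a) \<Rightarrow> ('a \<Rightarrow> real) \<Rightarrow> 'a \<Rightarrow> real" where
  "normal_deriv \<Omega> \<nu> f x = frechet_derivative f (at x within closure \<Omega>) (\<nu> x)"

definition locally_hoelder_on :: "real \<Rightarrow> ('b::metric_space \<Rightarrow> real) \<Rightarrow> 'b set \<Rightarrow> bool" where
  "locally_hoelder_on \<alpha> f S \<longleftrightarrow>
     (\<forall>K. compact K \<and> K \<subseteq> S \<longrightarrow>
        (\<exists>C. \<forall>z\<in>K. \<forall>w\<in>K. \<bar>f z - f w\<bar> \<le> C * dist z w powr \<alpha>))"

definition cylinder :: "'a::euclidean_space set \<Rightarrow> real \<Rightarrow> ('a \<times> real) set" where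
  "cylinder \<Omega> T = \<Omega> \<times> {0<..<T}"

definition lateral_boundary :: "'a::euclidean_space set \<Rightarrow> real \<Rightarrow> ('a \<times> real) set" where
  "lateral_boundary \<Omega> T = frontier \<Omega> \<times> {0<..<T}"

definition parabolic_boundary :: "'a::euclidean_space set \<Rightarrow> real \<Rightarrow> ('a \<times> real) set" where
  "parabolic_boundary \<Omega> T = lateral_boundary \<Omega> T \<union> closure \<Omega> \<times> {0}"

definition C21_cylinder ::
    "'a::euclidean_space set \<Rightarrow> real \<Rightarrow> ('a \<Rightarrow> real \<Rightarrow> real) \<Rightarrow> bool" where
  "C21_cylinder \<Omega> T u \<longleftrightarrow>
     (\<forall>t\<in>{0<..<T}. Ck_on 2 (\<lambda>x. u x t) \<Omega>) \<and>
     (\<forall>x\<in>\<Omega>. u x differentiable_on {0<..<T}) \<and>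
     continuous_on (cylinder \<Omega> T) (\<lambda>(x, t). u x t) \<and>
     (\<forall>b\<in>Basis. continuous_on (cylinder \<Omega> T) (\<lambda>(x, t). partial_deriv \<Omega> b (\<lambda>y. u y t) x)) \<and>
     (\<forall>b\<in>Basis. \<forall>b'\<in>Basis. continuous_on (cylinder \<Omega> T)
        (\<lambda>(x, t). partial_deriv \<Omega> b' (partial_deriv \<Omega> b (\<lambda>y. u y t)) x)) \<and>
     continuous_on (cylinder \<Omega> T) (\<lambda>(x, t). deriv (u x) t)"

text \<open>The union of the cylinder and its parabolic boundary is \<open>closure \<Omega> \<times> {0..<T}\<close>.\<close>

definition C10_closed_cylinder ::
    "'a::euclidean_space set \<Rightarrow> real \<Rightarrow> ('a \<Rightarrow> real \<Rightarrow> real) \<Rightarrow> bool" where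
  "C10_closed_cylinder \<Omega> T u \<longleftrightarrow>
     (\<forall>t\<in>{0..<T}. (\<lambda>x. u x t) differentiable_on closure \<Omega>) \<and>
     continuous_on (cylinder \<Omega> T \<union> parabolic_boundary \<Omega> T) (\<lambda>(x, t). u x t) \<and>
     (\<forall>b\<in>Basis. continuous_on (cylinder \<Omega> T \<union> parabolic_boundary \<Omega> T)
        (\<lambda>(x, t). partial_deriv (closure \<Omega>) b (\<lambda>y. u y t) x))"

definition nonneg_admissible ::
    "'a::euclidean_space set \<Rightarrow> real \<Rightarrow> ('a \<Rightarrow> real \<Rightarrow> real) \<Rightarrow> bool" where
  "nonneg_admissible \<Omega> T u \<longleftrightarrow>
     C21_cylinder \<Omega> T u \<and> C10_closed_cylinder \<Omega> T u \<and>
     (\<forall>(x, t)\<in>cylinder \<Omega> T \<union> parabolic_boundary \<Omega> T. 0 \<le> u x t)"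

text \<open>
  Powers are taken with \<open>powr\<close>, applied to nonnegative bases and positive exponents only, where
  \<open>0 powr p = 0\<close> is the intended value.
\<close>

definition supersolution ::
    "'a::euclidean_space set \<Rightarrow> ('a \<Rightarrow> 'a) \<Rightarrow> ('a \<Rightarrow> real \<Rightarrow> real) \<Rightarrow> ('a \<Rightarrow> 'a \<Rightarrow> real \<Rightarrow> real) \<Rightarrow>
     real \<Rightarrow> real \<Rightarrow> ('a \<Rightarrow> real) \<Rightarrow> real \<Rightarrow> ('a \<Rightarrow> real \<Rightarrow> real) \<Rightarrow> bool" where
  "supersolution \<Omega> \<nu> c k p l u\<^sub>0 T u \<longleftrightarrow>
     nonneg_admissible \<Omega> T u \<and>
     (\<forall>(x, t)\<in>cylinder \<Omega> T.
        deriv (u x) t \<ge> laplacian \<Omega> (\<lambda>y. u y t) x + c x t * u x t powr p) \<and>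
     (\<forall>(x, t)\<in>lateral_boundary \<Omega> T.
        normal_deriv \<Omega> \<nu> (\<lambda>y. u y t) x \<ge> (LINT y:\<Omega>|lborel. k x y t * u y t powr l)) \<and>
     (\<forall>x\<in>\<Omega>. u x 0 \<ge> u\<^sub>0 x)"

definition subsolution ::
    "'a::euclidean_space set \<Rightarrow> ('a \<Rightarrow> 'a) \<Rightarrow> ('a \<Rightarrow> real \<Rightarrow> real) \<Rightarrow> ('a \<Rightarrow> 'a \<Rightarrow> real \<Rightarrow> real) \<Rightarrow>
     real \<Rightarrow> real \<Rightarrow> ('a \<Rightarrow> real) \<Rightarrow> real \<Rightarrow> ('a \<Rightarrow> real \<Rightarrow> real) \<Rightarrow> bool" where
  "subsolution \<Omega> \<nu> c k p l u\<^sub>0 T u \<longleftrightarrow>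
     nonneg_admissible \<Omega> T u \<and>
     (\<forall>(x, t)\<in>cylinder \<Omega> T.
        deriv (u x) t \<le> laplacian \<Omega> (\<lambda>y. u y t) x + c x t * u x t powr p) \<and>
     (\<forall>(x, t)\<in>lateral_boundary \<Omega> T.
        normal_deriv \<Omega> \<nu> (\<lambda>y. u y t) x \<le> (LINT y:\<Omega>|lborel. k x y t * u y t powr l)) \<and>
     (\<forall>x\<in>\<Omega>. u x 0 \<le> u\<^sub>0 x)"

definition solution ::
    "'a::euclidean_space set \<Rightarrow> ('a \<Rightarrow> 'a) \<Rightarrow> ('a \<Rightarrow> real \<Rightarrow> real) \<Rightarrow> ('a \<Rightarrow> 'a \<Rightarrow> real \<Rightarrow> real) \<Rightarrow>
     real \<Rightarrow> real \<Rightarrow> ('a \<Rightarrow> real) \<Rightarrow> real \<Rightarrow> ('a \<Rightarrow> real \<Rightarrow> real) \<Rightarrow> bool" where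
  "solution \<Omega> \<nu> c k p l u\<^sub>0 T u \<longleftrightarrow>
     subsolution \<Omega> \<nu> c k p l u\<^sub>0 T u \<and> supersolution \<Omega> \<nu> c k p l u\<^sub>0 T u"

end

theory Submission imports Defs begin

text \<open>
  Two solutions are compared through the difference \<open>w = u - v\<close>.  A first application of the maximum
  principle to \<open>\<delta> - v\<close>, where \<open>\<delta>\<close> bounds the initial datum from below, shows that every solution is
  at least \<open>\<delta>\<close> (\<open>supersolution_ge_initial_bound\<close>): the reaction term and the boundary flux are both
  nonnegative.  Therefore solutions on \<open>[0, \<tau>]\<close> with \<open>\<tau> < T\<close> take values in a compact interval on which
  \<open>s powr p\<close> and \<open>s powr l\<close> are Lipschitz: either both exponents are at least \<open>1\<close>, or \<open>\<delta> > 0\<close> keeps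
  the values away from the singularity of the derivative at \<open>0\<close> (\<open>powr_diff_le\<close>).  On the set where
  \<open>w > 0\<close> this gives \<open>w\<^sub>t \<le> \<Delta>w + A w\<close>, and on the boundary the normal derivative of \<open>w\<close> is at most
  \<open>M \<integral> max 0 w\<close>.
  
  The heart of the proof is a maximum principle for such nonlocal inequalities
  (\<open>parabolic_comparison\<close>).  Its barrier is \<open>m exp (\<mu> t) \<psi> x\<close>, where \<open>1 \<le> \<psi> \<le> 3\<close> and the normal
  derivative of \<open>\<psi>\<close> exceeds \<open>M \<integral> \<psi>\<close>.  If \<open>w\<close> were positive somewhere, the smallest admissible \<open>m\<close>
  would be positive and the barrier would touch \<open>w\<close> from above at some point.  At an interior point
  this is impossible when \<open>\<mu>\<close> is large, by the second derivative test; at a boundary point it is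
  impossible because there \<open>w\<close> would have to increase towards the boundary at least as fast as the
  barrier does, while its flux is at most \<open>M\<close> times the integral of the barrier.
  
  A function \<open>\<psi>\<close> of bounded size and arbitrarily large flux is \<open>2 + sin (N \<rho>)\<close>, where \<open>\<rho>\<close> is twice
  continuously differentiable on the whole space, vanishes on the boundary and has normal derivative
  at least \<open>1\<close> there (\<open>boundary_function\<close>).  Such a \<open>\<rho>\<close> is a finite sum of local defining functions
  multiplied by nonnegative cutoffs: as defining functions vanish on the boundary, the derivatives
  of the cutoffs do not contribute to the flux.
\<close>

section \<open>Smooth functions on open sets\<close>

lemma partial_deriv_eq:
  assumes "open S" "x \<in> S" "(f has_derivative D) (at x)"
  shows "partial_deriv S b f x = D b"
  using assms frechet_derivative_at[of f D x]
  by (simp add: partial_deriv_def at_within_open_NO_MATCH)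

lemma has_derivative_partial_deriv:
  assumes "open S" "x \<in> S" "f differentiable_on S"
  shows "(f has_derivative (\<lambda>h. partial_deriv S h f x)) (at x)"
proof -
  have "f differentiable (at x)"
    using assms by (simp add: differentiable_on_eq_differentiable_at)
  then show ?thesis
    using assms by (simp add: partial_deriv_def at_within_open_NO_MATCH frechet_derivative_works)
qed

text \<open>
  The derivative is selected by a choice operator, so it depends on the set of all derivatives only.
  For this reason the equation holds on every set \<open>S\<close>, even where derivatives are not unique.
\<close>

lemma partial_deriv_cong:
  assumes "x \<in> S" "\<And>y. y \<in> S \<Longrightarrow> f y = g y"
  shows "partial_deriv S b f x = partial_deriv S b g x"
proof -
  have "(f has_derivative D) (at x within S) \<longleftrightarrow> (g has_derivative D) (at x within S)" for D
    using assms by (metis has_derivative_transform)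
  then show ?thesis by (simp add: partial_deriv_def frechet_derivative_def)
qed

lemma differentiable_on_cong_imp:
  assumes "f differentiable_on S" "\<And>x. x \<in> S \<Longrightarrow> f x = g x"
  shows "g differentiable_on S"
  using assms has_derivative_transform[of _ S g f]
  unfolding differentiable_on_def differentiable_def by metis

lemma Ck_on_cong:
  assumes "\<And>x. x \<in> S \<Longrightarrow> f x = g x"
  shows "Ck_on m f S \<longleftrightarrow> Ck_on m g S"
  using assms
proof (induction m arbitrary: f g)
  case 0
  then show ?case by (simp cong: continuous_on_cong)
next
  case (Suc m)
  have "f differentiable_on S \<longleftrightarrow> g differentiable_on S"
    using Suc.prems by (metis differentiable_on_cong_imp)
  moreover have "Ck_on m (partial_deriv S b f) S \<longleftrightarrow> Ck_on m (partial_deriv S b g) S" for b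
    by (rule Suc.IH) (use Suc.prems in \<open>auto intro: partial_deriv_cong\<close>)
  ultimately show ?case by simp
qed

text \<open>
  On open sets iterated partial derivatives can be taken within the whole space.  In this form the
  derivatives that belong to different open sets are the same functions, and smoothness can be
  restricted and glued.
\<close>

lemma Ck_on_Suc_iff_UNIV:
  assumes "open S"
  shows "Ck_on (Suc m) f S \<longleftrightarrow>
    f differentiable_on S \<and> (\<forall>b\<in>Basis. Ck_on m (partial_deriv UNIV b f) S)"
proof -
  have "Ck_on m (partial_deriv S b f) S \<longleftrightarrow> Ck_on m (partial_deriv UNIV b f) S" for b
    by (rule Ck_on_cong) (simp add: partial_deriv_def at_within_open_NO_MATCH assms)
  then show ?thesis by simp
qed

lemma Ck_on_Suc_imp: "Ck_on (Suc m) f S \<Longrightarrow> Ck_on m f S"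
proof (induction m arbitrary: f)
  case 0
  then show ?case by (auto intro: differentiable_imp_continuous_on)
next
  case (Suc m)
  then show ?case by auto
qed

lemma Ck_on_imp_continuous_on: "Ck_on m f S \<Longrightarrow> continuous_on S f"
  by (cases m) (auto intro: differentiable_imp_continuous_on)

lemma Ck_on_open_subset:
  assumes "open S" "open U" "S \<subseteq> U" "Ck_on m f U"
  shows "Ck_on m f S"
  using assms(4)
proof (induction m arbitrary: f)
  case 0
  then show ?case using assms by (auto intro: continuous_on_subset)
next
  case (Suc m)
  then show ?case
    using assms by (auto simp: Ck_on_Suc_iff_UNIV simp del: Ck_on.simps(2) intro: differentiable_on_subset)
qed

lemma Ck_on_open_Un:
  assumes "open S" "open U" "Ck_on m f S" "Ck_on m f U"
  shows "Ck_on m f (S \<union> U)"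
  using assms(3,4)
proof (induction m arbitrary: f)
  case 0
  then show ?case using assms by (auto intro: continuous_on_open_Un)
next
  case (Suc m)
  then show ?case
    using assms by (auto simp: Ck_on_Suc_iff_UNIV open_Un differentiable_on_eq_differentiable_at
        simp del: Ck_on.simps(2))
qed

lemma Ck_on_const: "open S \<Longrightarrow> Ck_on m (\<lambda>x. a) S"
proof (induction m arbitrary: a)
  case (Suc m)
  have "Ck_on m (partial_deriv S b (\<lambda>x. a)) S" for b
  proof -
    have "Ck_on m (partial_deriv S b (\<lambda>x. a)) S \<longleftrightarrow> Ck_on m (\<lambda>x. 0) S"
      by (rule Ck_on_cong) (use Suc.prems in \<open>auto intro: partial_deriv_eq\<close>)
    then show ?thesis using Suc by simp
  qed
  then show ?case by simp
qed simp

lemma Ck_on_add: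
  assumes "open S" "Ck_on m f S" "Ck_on m g S"
  shows "Ck_on m (\<lambda>x. f x + g x) S"
  using assms(2,3)
proof (induction m arbitrary: f g)
  case 0
  then show ?case by (auto intro: continuous_intros)
next
  case (Suc m)
  have "partial_deriv S b (\<lambda>x. f x + g x) x = partial_deriv S b f x + partial_deriv S b g x"
    if x: "x \<in> S" for b x
    using Suc.prems
    by (intro partial_deriv_eq assms(1) x has_derivative_add has_derivative_partial_deriv) auto
  then have "Ck_on m (partial_deriv S b (\<lambda>x. f x + g x)) S \<longleftrightarrow>
      Ck_on m (\<lambda>x. partial_deriv S b f x + partial_deriv S b g x) S" for b
    by (rule Ck_on_cong)
  then show ?case using Suc by (auto intro: differentiable_on_add)
qed

lemma Ck_on_mult:
  assumes "open S" "Ck_on m f S" "Ck_on m g S"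
  shows "Ck_on m (\<lambda>x. f x * g x) S"
  using assms(2,3)
proof (induction m arbitrary: f g)
  case 0
  then show ?case by (auto intro: continuous_intros)
next
  case (Suc m)
  have "partial_deriv S b (\<lambda>x. f x * g x) x
      = f x * partial_deriv S b g x + partial_deriv S b f x * g x"
    if x: "x \<in> S" for b x
    using Suc.prems
    by (intro partial_deriv_eq assms(1) x has_derivative_mult has_derivative_partial_deriv) auto
  then have "Ck_on m (partial_deriv S b (\<lambda>x. f x * g x)) S \<longleftrightarrow>
      Ck_on m (\<lambda>x. f x * partial_deriv S b g x + partial_deriv S b f x * g x) S" for b
    by (rule Ck_on_cong)
  moreover have "Ck_on m (\<lambda>x. f x * partial_deriv S b g x + partial_deriv S b f x * g x) S"
    if "b \<in> Basis" for b
    using Suc.prems that Ck_on_Suc_imp[OF Suc.prems(1)] Ck_on_Suc_imp[OF Suc.prems(2)]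
    by (intro Ck_on_add Suc.IH assms(1)) auto
  moreover have "(\<lambda>x. f x * g x) differentiable_on S"
    using Suc.prems by (auto simp: differentiable_on_def)
  ultimately show ?case by simp
qed

lemma Ck_on_sum:
  assumes "open S" "\<And>i. i \<in> I \<Longrightarrow> Ck_on m (f i) S"
  shows "Ck_on m (\<lambda>x. \<Sum>i\<in>I. f i x) S"
  using assms(2)
  by (induction I rule: infinite_finite_induct) (auto intro: Ck_on_const Ck_on_add assms(1))

text \<open>
  The sequence \<open>h\<close> lists an outer function of one real variable together with its successive
  derivatives, so that the induction on \<open>m\<close> shifts the sequence by one.
\<close>

lemma Ck_on_compose:
  fixes h :: "nat \<Rightarrow> real \<Rightarrow> real"
  assumes "open S" "\<And>j s. j < m \<Longrightarrow> (h j has_real_derivative h (Suc j) s) (at s)"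
    and "continuous_on UNIV (h m)" "Ck_on m f S"
  shows "Ck_on m (\<lambda>x. h 0 (f x)) S"
  using assms(2-4)
proof (induction m arbitrary: h)
  case 0
  then show ?case
    using continuous_on_compose2[of UNIV "h 0" S f] by simp
next
  case (Suc m)
  have ev: "((\<lambda>x. h 0 (f x)) has_derivative (\<lambda>v. h (Suc 0) (f x) * D v)) (at x)"
    if "(f has_derivative D) (at x)" for D x
    using has_derivative_compose[OF that Suc.prems(1)[of 0 "f x", unfolded has_field_derivative_def]]
    by simp
  have "partial_deriv S b (\<lambda>x. h 0 (f x)) x = h (Suc 0) (f x) * partial_deriv S b f x"
    if x: "x \<in> S" for b x
    using Suc.prems
    by (intro partial_deriv_eq[OF _ _ ev] assms(1) x has_derivative_partial_deriv) auto
  then have "Ck_on m (partial_deriv S b (\<lambda>x. h 0 (f x))) S \<longleftrightarrow>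
      Ck_on m (\<lambda>x. h (Suc 0) (f x) * partial_deriv S b f x) S" for b
    by (rule Ck_on_cong)
  moreover have "Ck_on m (\<lambda>x. h (Suc 0) (f x)) S"
    by (rule Suc.IH[of "\<lambda>j. h (Suc j)"])
       (use Suc.prems Ck_on_Suc_imp[OF Suc.prems(3)] in auto)
  moreover have "(\<lambda>x. h 0 (f x)) differentiable_on S"
    unfolding differentiable_on_def
  proof
    fix x assume "x \<in> S"
    then have "(f has_derivative (\<lambda>h. partial_deriv S h f x)) (at x)"
      using Suc.prems by (intro has_derivative_partial_deriv assms(1)) auto
    from ev[OF this] show "(\<lambda>x. h 0 (f x)) differentiable at x within S"
      by (meson differentiable_at_withinI differentiableI)
  qed
  ultimately show ?case
    using Suc.prems by (auto intro: Ck_on_mult assms(1))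
qed

lemma Ck_on_inner: "open S \<Longrightarrow> Ck_on m (\<lambda>x. inner c x + d) S"
proof (cases m)
  case (Suc n)
  assume S: "open S"
  have d: "((\<lambda>x. inner c x + d) has_derivative (\<lambda>h. inner c h)) (at x)" for x
    by (auto intro!: derivative_eq_intros)
  have "Ck_on n (partial_deriv S b (\<lambda>x. inner c x + d)) S \<longleftrightarrow> Ck_on n (\<lambda>x. inner c b) S" for b
    by (rule Ck_on_cong) (rule partial_deriv_eq[OF S _ d])
  moreover have "(\<lambda>x. inner c x + d) differentiable_on S"
    by (auto simp: differentiable_on_def intro!: differentiable_at_withinI differentiableI[OF d])
  ultimately show ?thesis using Suc S by (simp add: Ck_on_const)
qed (auto intro!: continuous_intros)

lemma Ck_on_norm_squared:
  fixes a :: "'a::euclidean_space"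
  assumes S: "open S"
  shows "Ck_on m (\<lambda>x. (norm (x - a))\<^sup>2) S"
proof -
  have "Ck_on m (\<lambda>x. \<Sum>b\<in>Basis. (inner b x + - inner b a) * (inner b x + - inner b a)) S"
    by (intro Ck_on_sum Ck_on_mult Ck_on_inner S)
  moreover have "(\<Sum>b\<in>Basis. (inner b x + - inner b a) * (inner b x + - inner b a)) = (norm (x - a))\<^sup>2" for x
  proof -
    have "(\<Sum>b\<in>Basis. (inner b x + - inner b a) * (inner b x + - inner b a))
        = (\<Sum>b\<in>Basis. inner (x - a) b * inner (x - a) b)"
      by (simp add: inner_diff_left inner_commute[of _ x] inner_commute[of _ a])
    then show ?thesis by (simp only: power2_norm_eq_inner euclidean_inner[symmetric])
  qed
  ultimately show ?thesis by simp
qed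

lemma laplacian_add_scaled:
  assumes S: "open S" "x \<in> S" and f: "Ck_on 2 f S" and g: "Ck_on 2 g S"
  shows "laplacian S (\<lambda>y. f y + a * g y) x = laplacian S f x + a * laplacian S g x"
proof -
  have f2: "f differentiable_on S" "\<And>b. b \<in> Basis \<Longrightarrow> partial_deriv S b f differentiable_on S"
    and g2: "g differentiable_on S" "\<And>b. b \<in> Basis \<Longrightarrow> partial_deriv S b g differentiable_on S"
    using f g by (auto simp: numeral_2_eq_2)
  have lin: "partial_deriv S b (\<lambda>y. F y + a * G y) z = partial_deriv S b F z + a * partial_deriv S b G z"
    if z: "z \<in> S" and F: "F differentiable_on S" and G: "G differentiable_on S" for F G b z
    by (intro partial_deriv_eq[OF S(1) z] has_derivative_add has_derivative_mult_right
        has_derivative_partial_deriv S(1) z F G)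
  have "partial_deriv S b (partial_deriv S b (\<lambda>y. f y + a * g y)) x
     = partial_deriv S b (partial_deriv S b f) x + a * partial_deriv S b (partial_deriv S b g) x"
    if "b \<in> Basis" for b
  proof -
    have "partial_deriv S b (partial_deriv S b (\<lambda>y. f y + a * g y)) x
      = partial_deriv S b (\<lambda>z. partial_deriv S b f z + a * partial_deriv S b g z) x"
      by (rule partial_deriv_cong[OF S(2)]) (rule lin[OF _ f2(1) g2(1)])
    also have "\<dots> = partial_deriv S b (partial_deriv S b f) x + a * partial_deriv S b (partial_deriv S b g) x"
      by (rule lin[OF S(2) f2(2)[OF that] g2(2)[OF that]])
    finally show ?thesis .
  qed
  then show ?thesis by (simp add: laplacian_def sum.distrib sum_distrib_left)
qed

lemma Ck_on_add_scaled:
  assumes "open S" "Ck_on m f S" "Ck_on m g S"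
  shows "Ck_on m (\<lambda>y. f y + a * g y) S"
  using assms by (intro Ck_on_add Ck_on_mult Ck_on_const)

lemma has_real_derivative_along_line:
  assumes "(f has_derivative D) (at (x + s *\<^sub>R d))"
  shows "((\<lambda>s. f (x + s *\<^sub>R d)) has_real_derivative D d) (at s)"
proof -
  have "((\<lambda>s. x + s *\<^sub>R d) has_derivative (\<lambda>h. h *\<^sub>R d)) (at s)"
    by (auto intro!: derivative_eq_intros)
  from has_derivative_compose[OF this, of f D] assms
  have "((\<lambda>s. f (x + s *\<^sub>R d)) has_derivative (\<lambda>h. D (h *\<^sub>R d))) (at s)" by simp
  moreover have "D (h *\<^sub>R d) = D d * h" for h
    using linear_cmul[OF has_derivative_linear[OF assms]] by simp
  ultimately show ?thesis by (simp add: has_field_derivative_def)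
qed

text \<open>
  Along each coordinate direction the first derivative vanishes at the maximum.  Were the second one
  positive, the first would be positive immediately to the right, and the function would increase.
\<close>

lemma laplacian_nonpos_at_max:
  assumes S: "open S" "x \<in> S" and f: "Ck_on 2 f S"
    and max: "\<And>y. y \<in> S \<Longrightarrow> f y \<le> f x"
  shows "laplacian S f x \<le> 0"
  unfolding laplacian_def
proof (rule sum_nonpos)
  fix b :: 'a assume b: "b \<in> Basis"
  have f2: "f differentiable_on S" "partial_deriv S b f differentiable_on S"
    using f b by (auto simp: numeral_2_eq_2)
  define g where "g s = f (x + s *\<^sub>R b)" for s
  define g' where "g' s = partial_deriv S b f (x + s *\<^sub>R b)" for s
  obtain e where e: "e > 0" "ball x e \<subseteq> S" using S open_contains_ball by blast
  have inS: "x + s *\<^sub>R b \<in> S" if "\<bar>s\<bar> < e" for s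
    using e that b by (auto simp: dist_norm subset_iff)
  have dg: "(g has_real_derivative g' s) (at s)" if s: "\<bar>s\<bar> < e" for s
    unfolding g_def[abs_def] g'_def
    by (intro has_real_derivative_along_line has_derivative_partial_deriv S(1) inS[OF s] f2(1))
  have dg': "(g' has_real_derivative partial_deriv S b (partial_deriv S b f) x) (at 0)"
    using has_real_derivative_along_line[of "partial_deriv S b f" _ x 0 b,
        OF has_derivative_partial_deriv[OF S(1) _ f2(2)]] S(2)
    unfolding g'_def[abs_def] by simp
  have g0: "g' 0 = 0"
    by (rule DERIV_local_max[OF dg[of 0], of e])
       (use e max inS in \<open>auto simp: g_def\<close>)
  show "partial_deriv S b (partial_deriv S b f) x \<le> 0"
  proof (rule ccontr)
    assume "\<not> ?thesis"
    then obtain d where d: "d > 0" "\<And>h. h > 0 \<Longrightarrow> h < d \<Longrightarrow> g' 0 < g' (0 + h)"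
      using DERIV_pos_inc_right[OF dg'] by auto
    define s where "s = min d e / 2"
    have s: "0 < s" "s < d" "s < e" using d e by (auto simp: s_def)
    obtain z where z: "0 < z" "z < s" "g s - g 0 = (s - 0) * g' z"
      using MVT2[of 0 s g g'] dg s by auto
    have "g' z > 0" using d(2)[of z] z s g0 by simp
    then have "(s - 0) * g' z > 0" using z by (intro mult_pos_pos) auto
    then have "g s > g 0" using z(3) by linarith
    then show False using max[OF inS[of s]] s by (simp add: g_def)
  qed
qed

lemma laplacian_bounded:
  fixes \<psi> :: "'a::euclidean_space \<Rightarrow> real"
  assumes "Ck_on 2 \<psi> UNIV" "open S" "bounded S"
  obtains B where "\<And>x. x \<in> S \<Longrightarrow> laplacian S \<psi> x \<le> B"
proof -
  have eq: "laplacian S \<psi> x = laplacian UNIV \<psi> x" if "x \<in> S" for x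
  proof -
    have "partial_deriv S b (partial_deriv S b \<psi>) x = partial_deriv S b (partial_deriv UNIV b \<psi>) x" for b
      by (rule partial_deriv_cong[OF that]) (simp add: partial_deriv_def at_within_open_NO_MATCH assms)
    then show ?thesis using that assms
      by (simp add: laplacian_def) (simp add: partial_deriv_def at_within_open_NO_MATCH)
  qed
  have "continuous_on UNIV (partial_deriv UNIV b (partial_deriv UNIV b \<psi>))" if "b \<in> Basis" for b
    using assms(1) that by (simp add: numeral_2_eq_2)
  then have "continuous_on UNIV (\<lambda>x. laplacian UNIV \<psi> x)"
    unfolding laplacian_def by (intro continuous_on_sum) 
  then have "compact (laplacian UNIV \<psi> ` closure S)"
    using assms by (intro compact_continuous_image) (auto intro: continuous_on_subset simp: compact_closure)
  then obtain B where "\<forall>y\<in>laplacian UNIV \<psi> ` closure S. norm y \<le> B"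
    using compact_imp_bounded bounded_iff by metis
  then have B: "laplacian UNIV \<psi> x \<le> B" if "x \<in> closure S" for x
    using that by force
  then show ?thesis by (intro that[of B]) (simp add: eq closure_subset[THEN subsetD])
qed

section \<open>The boundary and its normal\<close>

lemma has_derivative_gradient:
  assumes "open S" "x \<in> S" "f differentiable_on S"
  shows "(f has_derivative (\<lambda>h. gradient S f x \<bullet> h)) (at x)"
proof -
  note d = has_derivative_partial_deriv[OF assms]
  have "partial_deriv S h f x = gradient S f x \<bullet> h" for h
  proof -
    have "partial_deriv S h f x = partial_deriv S (\<Sum>b\<in>Basis. (h \<bullet> b) *\<^sub>R b) f x"
      by (simp add: euclidean_representation)
    also have "\<dots> = (\<Sum>b\<in>Basis. (h \<bullet> b) * partial_deriv S b f x)"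
      by (simp add: linear_sum[OF has_derivative_linear[OF d]]
          linear_cmul[OF has_derivative_linear[OF d]])
    also have "\<dots> = gradient S f x \<bullet> h"
      by (simp add: gradient_def inner_sum_left inner_commute[of h] mult.commute)
    finally show ?thesis .
  qed
  then show ?thesis using d by simp
qed

lemma continuous_on_gradient:
  assumes "Ck_on (Suc m) f S"
  shows "continuous_on S (gradient S f)"
  unfolding gradient_def[abs_def]
  using assms by (intro continuous_intros) (auto intro: Ck_on_imp_continuous_on)

lemma gradient_eqI:
  assumes "open S" "x \<in> S" "(f has_derivative (\<lambda>h. v \<bullet> h)) (at x)"
  shows "gradient S f x = v"
proof -
  have "partial_deriv S b f x = v \<bullet> b" for b
    by (rule partial_deriv_eq[OF assms])
  then show ?thesis
    by (simp add: gradient_def euclidean_representation)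
qed

lemma local_defining_functionD:
  assumes "local_defining_function \<Omega> a U \<phi>"
  shows "open U" "a \<in> U" "Ck_on m \<phi> U" "\<phi> differentiable_on U"
    and "y \<in> U \<Longrightarrow> gradient U \<phi> y \<noteq> 0"
    and "y \<in> U \<Longrightarrow> y \<in> \<Omega> \<longleftrightarrow> \<phi> y < 0"
    and "y \<in> U \<Longrightarrow> y \<in> frontier \<Omega> \<longleftrightarrow> \<phi> y = 0"
  using assms Ck_on.simps(2)[of 0 \<phi> U] unfolding local_defining_function_def by blast+

lemma defining_function_along_line:
  assumes "local_defining_function \<Omega> a U \<phi>" "x \<in> U"
  shows "((\<lambda>s. \<phi> (x + s *\<^sub>R d)) has_real_derivative gradient U \<phi> x \<bullet> d) (at 0)"
proof -
  have "(\<phi> has_derivative (\<lambda>h. gradient U \<phi> x \<bullet> h)) (at (x + 0 *\<^sub>R d))"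
    using has_derivative_gradient[of U x \<phi>] local_defining_functionD[OF assms(1)] assms(2) by simp
  then show ?thesis by (rule has_real_derivative_along_line)
qed

lemma small_steps_remain:
  fixes x d :: "'a::real_normed_vector"
  assumes "open U" "x \<in> U"
  obtains e where "e > 0" "\<And>s. \<bar>s\<bar> < e \<Longrightarrow> x + s *\<^sub>R d \<in> U"
proof -
  obtain r where r: "r > 0" "ball x r \<subseteq> U" using assms open_contains_ball by blast
  have "x + s *\<^sub>R d \<in> U" if "\<bar>s\<bar> < r / (norm d + 1)" for s
  proof -
    have "\<bar>s\<bar> * norm d \<le> \<bar>s\<bar> * (norm d + 1)" by (simp add: algebra_simps)
    also have "\<dots> < r" using that by (simp add: pos_less_divide_eq add_nonneg_pos)
    finally have "dist x (x + s *\<^sub>R d) < r" by (simp add: dist_norm)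
    then show ?thesis using r by auto
  qed
  moreover have "r / (norm d + 1) > 0" using r by (simp add: add_nonneg_pos)
  ultimately show ?thesis using that by blast
qed

lemma inward_steps:
  assumes \<phi>: "local_defining_function \<Omega> a U \<phi>" and x: "x \<in> U" "x \<in> frontier \<Omega>"
    and d: "gradient U \<phi> x \<bullet> d < 0"
  obtains e where "e > 0" "\<And>s. 0 < s \<Longrightarrow> s < e \<Longrightarrow> x + s *\<^sub>R d \<in> \<Omega>"
proof -
  note D = local_defining_functionD[OF \<phi>]
  obtain e1 where e1: "e1 > 0" "\<And>s. s > 0 \<Longrightarrow> s < e1 \<Longrightarrow> \<phi> (x + s *\<^sub>R d) < \<phi> x"
    using DERIV_neg_dec_right[OF defining_function_along_line[OF \<phi> x(1)] d] by auto
  obtain e2 where e2: "e2 > 0" "\<And>s. \<bar>s\<bar> < e2 \<Longrightarrow> x + s *\<^sub>R d \<in> U"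
    using small_steps_remain[OF D(1) x(1)] by blast
  show ?thesis
  proof (rule that[of "min e1 e2"])
    fix s assume "0 < s" "s < min e1 e2"
    then show "x + s *\<^sub>R d \<in> \<Omega>"
      using e1(2)[of s] e2(2)[of s] D(6)[of "x + s *\<^sub>R d"] D(7)[OF x(1)] x(2) by auto
  qed (use e1 e2 in auto)
qed

text \<open>
  A direction in which one defining function decreases leads into \<open>\<Omega>\<close>, so no other defining function
  can increase in it.  If the unit gradients \<open>g1\<close> and \<open>n\<close> of two of them differed, then the direction
  \<open>n - g1\<close> would be of this forbidden kind.  Hence the normal \<open>n\<close>, which may be given by any defining
  function, is the unit gradient of every one.
\<close>

lemma outward_normal_unique:
  assumes \<phi>: "local_defining_function \<Omega> a U \<phi>" and x: "x \<in> U" "x \<in> frontier \<Omega>"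
    and n: "unit_outward_normal_at \<Omega> x n"
  shows "gradient U \<phi> x = norm (gradient U \<phi> x) *\<^sub>R n"
proof -
  obtain V \<eta> where \<eta>: "local_defining_function \<Omega> x V \<eta>"
    and n_eq: "n = gradient V \<eta> x /\<^sub>R norm (gradient V \<eta> x)"
    using n unfolding unit_outward_normal_at_def by blast
  note D = local_defining_functionD[OF \<phi>] and E = local_defining_functionD[OF \<eta>]
  define g where "g = gradient U \<phi> x"
  define h where "h = gradient V \<eta> x"
  define g1 where "g1 = g /\<^sub>R norm g"
  have g0: "g \<noteq> 0" and h0: "h \<noteq> 0" using D(5) E(2,5) x by (auto simp: g_def h_def)
  have g1: "norm g1 = 1" "g = norm g *\<^sub>R g1" using g0 by (auto simp: g1_def)
  have n1: "norm n = 1" "h = norm h *\<^sub>R n" using h0 by (auto simp: n_eq h_def)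
  have "g1 = n"
  proof (rule ccontr)
    assume ne: "g1 \<noteq> n"
    have "0 < (norm (g1 - n))\<^sup>2" using ne by simp
    also have "\<dots> = 2 - 2 * (g1 \<bullet> n)"
    proof -
      have "g1 \<bullet> g1 = 1" "n \<bullet> n = 1" using g1(1) n1(1) by (simp_all add: norm_eq_1)
      then show ?thesis
        unfolding power2_norm_eq_inner by (simp add: inner_diff_left inner_diff_right inner_commute)
    qed
    finally have lt: "g1 \<bullet> n < 1" by simp
    define d where "d = n - g1"
    have gd: "g \<bullet> d < 0"
    proof -
      have "g1 \<bullet> d < 0" using lt g1(1) by (simp add: d_def inner_diff norm_eq_1)
      then show ?thesis using g1(2) g0 by (metis inner_scaleR_left mult_pos_neg zero_less_norm_iff)
    qed
    have hd: "h \<bullet> d > 0"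
    proof -
      have "n \<bullet> d > 0" using lt n1(1) by (simp add: d_def inner_diff norm_eq_1 inner_commute)
      then show ?thesis using n1(2) h0 by (metis inner_scaleR_left mult_pos_pos zero_less_norm_iff)
    qed
    obtain e1 where e1: "e1 > 0" "\<And>s. 0 < s \<Longrightarrow> s < e1 \<Longrightarrow> x + s *\<^sub>R d \<in> \<Omega>"
      using inward_steps[OF \<phi> x] gd unfolding g_def by blast
    obtain e2 where e2: "e2 > 0" "\<And>s. s > 0 \<Longrightarrow> s < e2 \<Longrightarrow> \<eta> x < \<eta> (x + s *\<^sub>R d)"
      using DERIV_pos_inc_right[OF defining_function_along_line[OF \<eta> E(2)]] hd
      unfolding h_def by fastforce
    obtain e3 where e3: "e3 > 0" "\<And>s. \<bar>s\<bar> < e3 \<Longrightarrow> x + s *\<^sub>R d \<in> V"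
      using small_steps_remain[OF E(1,2)] by blast
    define s where "s = min e1 (min e2 e3) / 2"
    have s: "0 < s" "s < e1" "s < e2" "\<bar>s\<bar> < e3" using e1 e2 e3 by (auto simp: s_def)
    have "\<eta> (x + s *\<^sub>R d) < 0" using E(6)[OF e3(2)] e1(2) s by blast
    moreover have "\<eta> x = 0" using E(2,7) x by blast
    ultimately show False using e2(2)[of s] s by simp
  qed
  then show ?thesis using g1(2) by (simp add: g_def)
qed

section \<open>A bounded barrier with large flux\<close>

lemma has_real_derivative_max_power:
  "((\<lambda>s. (max 0 s) ^ Suc (Suc n)) has_real_derivative real (Suc (Suc n)) * (max 0 s) ^ Suc n) (at (s::real))"
proof -
  consider "s < 0" | "s = 0" | "s > 0" by linarith
  then show ?thesis
  proof cases
    case 1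
    have "((\<lambda>s. 0::real) has_real_derivative 0) (at s)" by simp
    then have "((\<lambda>s. (max 0 s) ^ Suc (Suc n)) has_real_derivative 0) (at s)"
      by (rule has_field_derivative_transform_within_open[where S = "{..<0}"]) (use 1 in auto)
    then show ?thesis using 1 by simp
  next
    case 3
    have "((\<lambda>s::real. s ^ Suc (Suc n)) has_real_derivative real (Suc (Suc n)) * s ^ Suc n) (at s)"
      by (rule derivative_eq_intros | simp)+
    then have "((\<lambda>s. (max 0 s) ^ Suc (Suc n)) has_real_derivative real (Suc (Suc n)) * s ^ Suc n) (at s)"
      by (rule has_field_derivative_transform_within_open[where S = "{0<..}"]) (use 3 in auto)
    then show ?thesis using 3 by simp
  next
    case 2
    have "((\<lambda>h::real. max 0 h * max 0 h ^ n) \<longlongrightarrow> max 0 0 * max 0 0 ^ n) (at 0)"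
      by (intro tendsto_intros)
    then have "((\<lambda>h::real. max 0 h * max 0 h ^ n) \<longlongrightarrow> 0) (at 0)" by simp
    moreover have "\<forall>\<^sub>F h in at 0. max 0 h * max 0 h ^ n = (max 0 h * (max 0 h * max 0 h ^ n)) / (h::real)"
      by (auto simp: eventually_at_filter max_def)
    ultimately have "((\<lambda>h::real. (max 0 h * (max 0 h * max 0 h ^ n)) / h) \<longlongrightarrow> 0) (at 0)"
      by (rule Lim_transform_eventually)
    then show ?thesis using 2 by (simp add: DERIV_def)
  qed
qed

text \<open>
  The cube is the smallest power of the positive part that is twice continuously differentiable; it
  serves as a cutoff.
\<close>

lemma Ck_on_max_cubed:
  assumes "open S" "Ck_on 2 f S"
  shows "Ck_on 2 (\<lambda>x. (max 0 (f x)) ^ 3) S"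
proof -
  define h :: "nat \<Rightarrow> real \<Rightarrow> real" where
    "h j s = (if j = 0 then (max 0 s) ^ 3 else if j = 1 then 3 * (max 0 s)\<^sup>2 else 6 * max 0 s)" for j s
  have "(h j has_real_derivative h (Suc j) s) (at s)" if "j < 2" for j s
  proof -
    have "j = 0 \<or> j = 1" using that by linarith
    then show ?thesis
    proof
      assume "j = 0"
      then show ?thesis
        using has_real_derivative_max_power[of 1 s] by (simp add: h_def[abs_def] eval_nat_numeral)
    next
      assume j: "j = 1"
      have "((\<lambda>s. 3 * (max 0 s) ^ 2) has_real_derivative 3 * (2 * max 0 s)) (at s)"
        using has_real_derivative_max_power[of 0 s]
        by (intro DERIV_cmult) (simp add: eval_nat_numeral)
      then show ?thesis using j by (simp add: h_def[abs_def])
    qed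
  qed
  moreover have "continuous_on UNIV (h 2)"
    unfolding h_def[abs_def] by (auto intro!: continuous_intros)
  ultimately have "Ck_on 2 (\<lambda>x. h 0 (f x)) S" using assms by (intro Ck_on_compose[of S 2 h f]) auto
  then show ?thesis by (simp add: h_def)
qed

lemma Ck_on_sin:
  assumes "open S" "Ck_on 2 f S"
  shows "Ck_on 2 (\<lambda>x. sin (f x)) S"
proof -
  define h :: "nat \<Rightarrow> real \<Rightarrow> real" where
    "h j s = (if j = 0 then sin s else if j = 1 then cos s else - sin s)" for j s
  have "(h j has_real_derivative h (Suc j) s) (at s)" if "j < 2" for j s
  proof -
    have "j = 0 \<or> j = 1" using that by linarith
    then show ?thesis
      by (auto simp: h_def[abs_def])
  qed
  moreover have "continuous_on UNIV (h 2)"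
    unfolding h_def[abs_def] by (auto intro!: continuous_intros)
  ultimately have "Ck_on 2 (\<lambda>x. h 0 (f x)) S" using assms by (intro Ck_on_compose[of S 2 h f]) auto
  then show ?thesis by (simp add: h_def)
qed

lemma Ck_on_2_differentiable: "Ck_on 2 f S \<Longrightarrow> f differentiable_on S"
  by (simp add: numeral_2_eq_2)

text \<open>
  Multiply a defining function \<open>\<phi>\<close> around \<open>a\<close> by a cutoff supported in a ball inside the domain \<open>U\<close> of
  \<open>\<phi>\<close>.  As \<open>\<phi>\<close> vanishes on the boundary, the product rule leaves only the cutoff times the
  gradient of \<open>\<phi>\<close>, which points along the normal.  The flux is therefore nonnegative on the
  boundary and positive at \<open>a\<close>, hence after scaling at least \<open>1\<close> in a neighbourhood \<open>V\<close> of \<open>a\<close>.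
\<close>

lemma local_boundary_function:
  assumes dom: "smooth_bounded_domain \<Omega>" and a: "a \<in> frontier \<Omega>"
  shows "\<exists>\<rho> V. Ck_on 2 \<rho> UNIV \<and> open V \<and> a \<in> V \<and>
    (\<forall>x\<in>frontier \<Omega>. \<rho> x = 0 \<and> (\<forall>n. unit_outward_normal_at \<Omega> x n \<longrightarrow>
       0 \<le> gradient UNIV \<rho> x \<bullet> n \<and> (x \<in> V \<longrightarrow> 1 \<le> gradient UNIV \<rho> x \<bullet> n)))"
proof -
  obtain U \<phi> where \<phi>: "local_defining_function \<Omega> a U \<phi>"
    using dom a unfolding smooth_bounded_domain_def by blast
  note D = local_defining_functionD[OF \<phi>]
  obtain r where r: "r > 0" "cball a r \<subseteq> U" using D(1,2) open_contains_cball by blast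
  define cut where "cut y = (max 0 (r\<^sup>2 + (-1) * (norm (y - a))\<^sup>2)) ^ 3" for y
  have cut2: "Ck_on 2 cut S" if "open S" for S
    unfolding cut_def[abs_def]
    by (intro Ck_on_max_cubed Ck_on_add_scaled Ck_on_const Ck_on_norm_squared that)
  have cut0: "cut y \<ge> 0" for y by (simp add: cut_def)
  have cuta: "cut a > 0" using r by (simp add: cut_def)
  have cutout: "cut y = 0" if "y \<notin> cball a r" for y
  proof -
    have "r\<^sup>2 \<le> (norm (y - a))\<^sup>2"
      using that r by (intro power_mono) (auto simp: dist_norm norm_minus_commute)
    then show ?thesis by (simp add: cut_def)
  qed
  define q where "q y = cut y * norm (gradient U \<phi> y)" for y
  have "continuous_on U q"
    unfolding q_def using Ck_on_imp_continuous_on[OF cut2[OF D(1)]] continuous_on_gradient[OF D(3)]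
    by (intro continuous_intros)
  moreover have qa: "q a > 0" using cuta D(2,5) by (simp add: q_def)
  ultimately have "open (U \<inter> q -` {q a / 2 <..})"
    using D(1) by (intro continuous_open_preimage) auto
  define V where "V = U \<inter> q -` {q a / 2 <..}"
  define K where "K = 2 / q a"
  have K: "K > 0" using qa by (simp add: K_def)
  define \<rho> where "\<rho> y = K * (cut y * \<phi> y)" for y
  have "Ck_on 2 \<rho> U"
    unfolding \<rho>_def[abs_def] by (intro Ck_on_mult Ck_on_const cut2 D)
  moreover have "Ck_on 2 \<rho> (- cball a r)"
  proof -
    have "Ck_on 2 \<rho> (- cball a r) \<longleftrightarrow> Ck_on 2 (\<lambda>y. 0) (- cball a r)"
      by (rule Ck_on_cong) (simp add: \<rho>_def cutout)
    then show ?thesis using Ck_on_const[of "- cball a r" 2 0] by (simp add: open_Compl)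
  qed
  moreover have "U \<union> - cball a r = UNIV" using r by auto
  ultimately have \<rho>2: "Ck_on 2 \<rho> UNIV"
    using Ck_on_open_Un[of U "- cball a r" 2 \<rho>] D(1) by (simp add: open_Compl)
  have grad: "\<rho> x = 0 \<and> gradient UNIV \<rho> x \<bullet> n = (if x \<in> U then K * q x else 0)"
    if x: "x \<in> frontier \<Omega>" and n: "unit_outward_normal_at \<Omega> x n" for x n
  proof (cases "x \<in> U")
    case True
    have \<phi>0: "\<phi> x = 0" using D(7) True x by blast
    have "(\<rho> has_derivative (\<lambda>h. K * (cut x * (gradient U \<phi> x \<bullet> h) + (gradient U cut x \<bullet> h) * \<phi> x))) (at x)"
      unfolding \<rho>_def[abs_def]
      by (intro has_derivative_mult_right has_derivative_mult has_derivative_gradient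
          Ck_on_2_differentiable cut2 D(1,4) True)
    then have "(\<rho> has_derivative (\<lambda>h. ((K * cut x) *\<^sub>R gradient U \<phi> x) \<bullet> h)) (at x)"
      using \<phi>0 by (simp add: mult.assoc)
    then have "gradient UNIV \<rho> x = (K * cut x) *\<^sub>R gradient U \<phi> x"
      by (intro gradient_eqI) auto
    moreover have "gradient U \<phi> x \<bullet> n = norm (gradient U \<phi> x)"
    proof -
      have "norm n = 1"
      proof -
        obtain W \<eta> where \<eta>: "local_defining_function \<Omega> x W \<eta>"
          "n = gradient W \<eta> x /\<^sub>R norm (gradient W \<eta> x)"
          using n unfolding unit_outward_normal_at_def by blast
        then show ?thesis using local_defining_functionD(2,5)[OF \<eta>(1)] by simp
      qed
      then show ?thesis
        by (subst outward_normal_unique[OF \<phi> True x n]) (simp add: norm_eq_1)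
    qed
    ultimately show ?thesis using True \<phi>0 by (simp add: q_def \<rho>_def)
  next
    case False
    then have xo: "x \<in> - cball a r" using r by auto
    have "(\<rho> has_derivative (\<lambda>h. 0 \<bullet> h)) (at x)"
    proof (rule has_derivative_transform_within_open[of "\<lambda>y. 0" _ _ _ "- cball a r"])
      show "((\<lambda>y. 0) has_derivative (\<lambda>h. 0 \<bullet> h)) (at x)" by simp
    qed (use xo in \<open>auto simp: \<rho>_def cutout open_Compl\<close>)
    then have "gradient UNIV \<rho> x = 0" by (intro gradient_eqI) auto
    then show ?thesis using False xo by (simp add: \<rho>_def cutout)
  qed
  have "\<rho> x = 0" if "x \<in> frontier \<Omega>" for x
  proof (cases "x \<in> U")
    case True
    then show ?thesis using D(7)[OF True] that by (simp add: \<rho>_def)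
  next
    case False
    then have "x \<notin> cball a r" using r by blast
    then show ?thesis by (simp add: \<rho>_def cutout)
  qed
  moreover have "0 \<le> K * q x" for x using K cut0 by (simp add: q_def)
  moreover have "1 \<le> K * q x" if "x \<in> V" for x
    using that qa by (auto simp: V_def K_def field_simps)
  moreover have "open V" "a \<in> V" "V \<subseteq> U"
    using \<open>open (U \<inter> q -` {q a / 2 <..})\<close> D(2) qa by (auto simp: V_def)
  ultimately show ?thesis
    using \<rho>2 grad by (intro exI[of _ \<rho>] exI[of _ V]) (auto split: if_splits)
qed

text \<open>
  Finitely many neighbourhoods \<open>V a\<close> cover the compact boundary.  The fluxes of the local functions
  are nonnegative, so that the flux of their sum is at least that of any single one.
\<close>

lemma boundary_function:
  assumes dom: "smooth_bounded_domain \<Omega>"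
  obtains \<rho> where "Ck_on 2 \<rho> UNIV" "\<And>x. x \<in> frontier \<Omega> \<Longrightarrow> \<rho> x = 0"
    "\<And>x n. x \<in> frontier \<Omega> \<Longrightarrow> unit_outward_normal_at \<Omega> x n \<Longrightarrow> 1 \<le> gradient UNIV \<rho> x \<bullet> n"
proof -
  have "\<forall>a\<in>frontier \<Omega>. \<exists>\<rho> V. Ck_on 2 \<rho> UNIV \<and> open V \<and> a \<in> V \<and>
    (\<forall>x\<in>frontier \<Omega>. \<rho> x = 0 \<and> (\<forall>n. unit_outward_normal_at \<Omega> x n \<longrightarrow>
       0 \<le> gradient UNIV \<rho> x \<bullet> n \<and> (x \<in> V \<longrightarrow> 1 \<le> gradient UNIV \<rho> x \<bullet> n)))"
    using local_boundary_function[OF dom] by blast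
  then obtain R V where RV: "\<And>a. a \<in> frontier \<Omega> \<Longrightarrow> Ck_on 2 (R a) UNIV \<and> open (V a) \<and> a \<in> V a \<and>
    (\<forall>x\<in>frontier \<Omega>. R a x = 0 \<and> (\<forall>n. unit_outward_normal_at \<Omega> x n \<longrightarrow>
       0 \<le> gradient UNIV (R a) x \<bullet> n \<and> (x \<in> V a \<longrightarrow> 1 \<le> gradient UNIV (R a) x \<bullet> n)))"
    by metis
  have "compact (frontier \<Omega>)"
    using dom by (auto simp: smooth_bounded_domain_def compact_frontier_bounded)
  then obtain C where C: "C \<subseteq> frontier \<Omega>" "finite C" "frontier \<Omega> \<subseteq> (\<Union>a\<in>C. V a)"
    by (rule compactE_image[of _ "frontier \<Omega>" V]) (use RV in auto)
  define \<rho> where "\<rho> x = (\<Sum>a\<in>C. R a x)" for x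
  show ?thesis
  proof (rule that[of \<rho>])
    show "Ck_on 2 \<rho> UNIV"
      unfolding \<rho>_def[abs_def] using C RV by (intro Ck_on_sum) auto
    fix x assume x: "x \<in> frontier \<Omega>"
    show "\<rho> x = 0" using C(1) RV x by (auto simp: \<rho>_def intro!: sum.neutral)
    fix n assume n: "unit_outward_normal_at \<Omega> x n"
    have "(\<rho> has_derivative (\<lambda>h. \<Sum>a\<in>C. gradient UNIV (R a) x \<bullet> h)) (at x)"
      unfolding \<rho>_def[abs_def] using C RV
      by (intro has_derivative_sum has_derivative_gradient Ck_on_2_differentiable) auto
    then have g: "gradient UNIV \<rho> x = (\<Sum>a\<in>C. gradient UNIV (R a) x)"
      by (intro gradient_eqI) (auto simp: inner_sum_left)
    obtain a where a: "a \<in> C" "x \<in> V a" using C(3) x by blast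
    have "1 \<le> gradient UNIV (R a) x \<bullet> n" using RV a C(1) x n by blast
    also have "\<dots> \<le> (\<Sum>a\<in>C. gradient UNIV (R a) x \<bullet> n)"
      using C RV x n a by (intro member_le_sum) auto
    finally show "1 \<le> gradient UNIV \<rho> x \<bullet> n" by (simp add: g inner_sum_left)
  qed
qed

text \<open>
  Composing with the sine bounds the size of \<open>N \<rho>\<close> without losing flux: on the boundary \<open>\<rho> = 0\<close>, where
  the sine has slope \<open>1\<close>.
\<close>

lemma steep_barrier:
  fixes N :: real
  assumes dom: "smooth_bounded_domain \<Omega>" and N: "N \<ge> 0"
  obtains \<psi> where "Ck_on 2 \<psi> UNIV" "\<And>x. 1 \<le> \<psi> x" "\<And>x. \<psi> x \<le> 3"
    "\<And>x n. x \<in> frontier \<Omega> \<Longrightarrow> unit_outward_normal_at \<Omega> x n \<Longrightarrow> N \<le> gradient UNIV \<psi> x \<bullet> n"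
proof -
  obtain \<rho> where \<rho>: "Ck_on 2 \<rho> UNIV" "\<And>x. x \<in> frontier \<Omega> \<Longrightarrow> \<rho> x = 0"
    "\<And>x n. x \<in> frontier \<Omega> \<Longrightarrow> unit_outward_normal_at \<Omega> x n \<Longrightarrow> 1 \<le> gradient UNIV \<rho> x \<bullet> n"
    using boundary_function[OF dom] by blast
  define \<psi> where "\<psi> x = 2 + sin (N * \<rho> x)" for x
  show ?thesis
  proof (rule that[of \<psi>])
    show "Ck_on 2 \<psi> UNIV"
      unfolding \<psi>_def[abs_def] by (intro Ck_on_add Ck_on_sin Ck_on_mult Ck_on_const \<rho>(1)) auto
    show "1 \<le> \<psi> x" "\<psi> x \<le> 3" for x
      unfolding \<psi>_def using sin_ge_minus_one[of "N * \<rho> x"] sin_le_one[of "N * \<rho> x"] by linarith+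
    fix x n assume x: "x \<in> frontier \<Omega>" and n: "unit_outward_normal_at \<Omega> x n"
    have "(\<rho> has_derivative (\<lambda>h. gradient UNIV \<rho> x \<bullet> h)) (at x)"
      using \<rho>(1) by (intro has_derivative_gradient Ck_on_2_differentiable) auto
    then have "(\<psi> has_derivative (\<lambda>h. (N * (gradient UNIV \<rho> x \<bullet> h)) * cos (N * \<rho> x))) (at x)"
      unfolding \<psi>_def[abs_def] by (auto intro!: derivative_eq_intros simp: mult.commute)
    then have "gradient UNIV \<psi> x = N *\<^sub>R gradient UNIV \<rho> x"
      using \<rho>(2)[OF x] by (intro gradient_eqI) auto
    then show "N \<le> gradient UNIV \<psi> x \<bullet> n"
      using mult_left_mono[OF \<rho>(3)[OF x n] N] by simp
  qed
qed

section \<open>The maximum principle\<close>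

lemma set_integrable_continuous_closure:
  fixes f :: "'a::euclidean_space \<Rightarrow> real"
  assumes "open \<Omega>" "bounded \<Omega>" "continuous_on (closure \<Omega>) f"
  shows "set_integrable lborel \<Omega> f"
proof (rule set_integrable_subset)
  show "set_integrable lborel (closure \<Omega>) f"
    unfolding set_integrable_def using assms
    by (intro borel_integrable_compact) (auto simp: compact_closure)
qed (use assms closure_subset in auto)

text \<open>
  Maximum principle for a flux condition that involves the integral of the positive part of \<open>w\<close>.  The
  quotient \<open>F\<close> of \<open>w\<close> by the barrier \<open>exp (\<mu> t) \<psi> x\<close> attains its maximum \<open>m\<close> on the compact cylinder
  at a point \<open>(a, s)\<close>.  If \<open>m > 0\<close>, then \<open>m exp (\<mu> t) \<psi> x\<close> lies above \<open>w\<close> at all times up to \<open>\<tau>\<close>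
  and touches it at \<open>(a, s)\<close>.  The initial inequality excludes \<open>s = 0\<close>, the differential inequality
  excludes \<open>a \<in> \<Omega>\<close>, and the flux condition excludes that \<open>a\<close> lies on the boundary.
  As \<open>s = \<tau>\<close> may occur, the time derivative at \<open>(a, s)\<close> is compared from the left only.
\<close>

lemma parabolic_comparison:
  fixes w :: "'a::euclidean_space \<Rightarrow> real \<Rightarrow> real" and A M \<tau> :: real
  assumes dom: "smooth_bounded_domain \<Omega>"
    and normal: "\<forall>x\<in>frontier \<Omega>. unit_outward_normal_at \<Omega> x (\<nu> x)"
    and M: "M \<ge> 0"
    and cont: "continuous_on (closure \<Omega> \<times> {0..\<tau>}) (\<lambda>(x, t). w x t)"
    and init: "\<And>x. x \<in> closure \<Omega> \<Longrightarrow> w x 0 \<le> 0"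
    and C2: "\<And>t. 0 < t \<Longrightarrow> t \<le> \<tau> \<Longrightarrow> Ck_on 2 (\<lambda>y. w y t) \<Omega>"
    and ineq: "\<And>x t. x \<in> \<Omega> \<Longrightarrow> 0 < t \<Longrightarrow> t \<le> \<tau> \<Longrightarrow> w x t > 0 \<Longrightarrow>
      \<exists>D. (w x has_real_derivative D) (at t) \<and> D \<le> laplacian \<Omega> (\<lambda>y. w y t) x + A * w x t"
    and bdry: "\<And>x t. x \<in> frontier \<Omega> \<Longrightarrow> 0 < t \<Longrightarrow> t \<le> \<tau> \<Longrightarrow>
      \<exists>D. ((\<lambda>y. w y t) has_derivative D) (at x within closure \<Omega>) \<and>
          D (\<nu> x) \<le> M * (LINT y:\<Omega>|lborel. max 0 (w y t))"
    and x: "x \<in> closure \<Omega>" and t: "0 \<le> t" "t \<le> \<tau>"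
  shows "w x t \<le> 0"
proof (rule ccontr)
  assume pos: "\<not> w x t \<le> 0"
  have \<Omega>: "open \<Omega>" "bounded \<Omega>" using dom by (auto simp: smooth_bounded_domain_def)
  have clc: "compact (closure \<Omega>)" using \<Omega> by (simp add: compact_closure)
  \<comment> \<open>As \<open>\<psi> \<le> 3\<close>, this exceeds \<open>M\<close> times the integral of \<open>\<psi>\<close>.\<close>
  define N where "N = M * (3 * measure lborel \<Omega>) + 1"
  have N: "N > 0" using M by (simp add: N_def add_nonneg_pos)
  obtain \<psi> where \<psi>: "Ck_on 2 \<psi> UNIV" "\<And>x. 1 \<le> \<psi> x" "\<And>x. \<psi> x \<le> 3"
    "\<And>x n. x \<in> frontier \<Omega> \<Longrightarrow> unit_outward_normal_at \<Omega> x n \<Longrightarrow> N \<le> gradient UNIV \<psi> x \<bullet> n"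
    using steep_barrier[OF dom, of N] N by auto
  have \<psi>pos: "\<psi> x > 0" for x using \<psi>(2)[of x] by linarith
  have \<psi>nz: "\<psi> x \<noteq> 0" for x using \<psi>pos[of x] by simp
  have \<psi>\<Omega>: "Ck_on 2 \<psi> \<Omega>" using Ck_on_open_subset[OF \<Omega>(1) _ _ \<psi>(1)] by simp
  have \<psi>c: "continuous_on UNIV \<psi>" using \<psi>(1) by (rule Ck_on_imp_continuous_on)
  obtain B where B: "\<And>x. x \<in> \<Omega> \<Longrightarrow> laplacian \<Omega> \<psi> x \<le> B"
    using laplacian_bounded[OF \<psi>(1) \<Omega>] by blast
  \<comment> \<open>As \<open>\<psi> \<ge> 1\<close>, the time derivative of the barrier then exceeds its Laplacian plus \<open>A\<close> times it.\<close>
  define \<mu> where "\<mu> = \<bar>A\<bar> + \<bar>B\<bar> + 1"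
  define F where "F = (\<lambda>(x, t). w x t / (exp (\<mu> * t) * \<psi> x))"
  have "continuous_on (closure \<Omega> \<times> {0..\<tau>}) F"
  proof -
    have "continuous_on (closure \<Omega> \<times> {0..\<tau>}) (\<lambda>z. \<psi> (fst z))"
      by (rule continuous_on_compose2[OF \<psi>c]) (auto intro!: continuous_intros)
    then have "continuous_on (closure \<Omega> \<times> {0..\<tau>})
      (\<lambda>z. (\<lambda>(x, t). w x t) z / (exp (\<mu> * snd z) * \<psi> (fst z)))"
      by (intro continuous_intros cont) (simp_all add: \<psi>nz)
    then show ?thesis by (simp add: F_def split_beta')
  qed
  moreover have "compact (closure \<Omega> \<times> {0..\<tau>})" using clc by (intro compact_Times) auto
  moreover have xt: "(x, t) \<in> closure \<Omega> \<times> {0..\<tau>}" using x t by simp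
  ultimately obtain z where z: "z \<in> closure \<Omega> \<times> {0..\<tau>}"
    "\<forall>y\<in>closure \<Omega> \<times> {0..\<tau>}. F y \<le> F z"
    using continuous_attains_sup[of "closure \<Omega> \<times> {0..\<tau>}" F] by blast
  obtain a s where as: "z = (a, s)" by (cases z)
  have a: "a \<in> closure \<Omega>" and s: "0 \<le> s" "s \<le> \<tau>" using z as by auto
  define m where "m = F (a, s)"
  have "F (x, t) > 0" using pos \<psi>pos by (simp add: F_def)
  moreover have "F (x, t) \<le> m" using z(2) xt as unfolding m_def by blast
  ultimately have m: "m > 0" by linarith
  have below: "w y r \<le> m * exp (\<mu> * r) * \<psi> y" if "y \<in> closure \<Omega>" "0 \<le> r" "r \<le> \<tau>" for y r
  proof -
    have "F (y, r) \<le> m" using z(2) as that unfolding m_def by auto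
    then show ?thesis using \<psi>pos[of y] by (simp add: F_def pos_divide_le_eq mult.assoc)
  qed
  have touch: "w a s = m * exp (\<mu> * s) * \<psi> a"
    using \<psi>pos[of a] by (simp add: m_def F_def)
  have wpos: "w a s > 0" using touch m \<psi>pos[of a] by simp
  have s0: "0 < s" using init[OF a] wpos s by (cases "s = 0") auto
  define q where "q = m * exp (\<mu> * s)"
  have q: "q > 0" using m by (simp add: q_def)
  consider "a \<in> \<Omega>" | "a \<in> frontier \<Omega>" using a \<Omega> by (auto simp: frontier_def interior_open)
  then show False
  proof cases
    case 1
    obtain D where D: "(w a has_real_derivative D) (at s)"
      "D \<le> laplacian \<Omega> (\<lambda>y. w y s) a + A * w a s"
      using ineq[OF 1 s0 s(2) wpos] by blast
    have "laplacian \<Omega> (\<lambda>y. w y s + (- q) * \<psi> y) a \<le> 0"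
    proof (rule laplacian_nonpos_at_max[OF \<Omega>(1) 1])
      show "Ck_on 2 (\<lambda>y. w y s + (- q) * \<psi> y) \<Omega>"
        using C2[OF s0 s(2)] \<psi>\<Omega> by (intro Ck_on_add_scaled \<Omega>)
      fix y assume "y \<in> \<Omega>"
      then have "y \<in> closure \<Omega>" using closure_subset by blast
      from below[OF this s] show "w y s + (- q) * \<psi> y \<le> w a s + (- q) * \<psi> a"
        using touch by (simp add: q_def)
    qed
    then have "laplacian \<Omega> (\<lambda>y. w y s) a \<le> q * laplacian \<Omega> \<psi> a"
      using laplacian_add_scaled[OF \<Omega>(1) 1 C2[OF s0 s(2)] \<psi>\<Omega>, of "- q"] by simp
    also have "\<dots> \<le> q * B" using B[OF 1] q by simp
    finally have up: "D \<le> q * B + A * (q * \<psi> a)" using D(2) touch by (simp add: q_def)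
    \<comment> \<open>Otherwise \<open>w\<close> would exceed the barrier just before time \<open>s\<close>.\<close>
    have low: "q * \<mu> * \<psi> a \<le> D"
    proof (rule ccontr)
      assume "\<not> ?thesis"
      then have neg: "D - q * \<mu> * \<psi> a < 0" by simp
      have "((\<lambda>r. w a r - m * exp (\<mu> * r) * \<psi> a) has_real_derivative D - q * \<mu> * \<psi> a) (at s)"
        unfolding q_def by (rule derivative_eq_intros D(1) refl | simp)+
      from DERIV_neg_dec_left[OF this neg] obtain d where d: "d > 0"
        "\<And>h. h > 0 \<Longrightarrow> h < d \<Longrightarrow> w a s - m * exp (\<mu> * s) * \<psi> a
            < w a (s - h) - m * exp (\<mu> * (s - h)) * \<psi> a"
        by auto
      define h where "h = min d s / 2"
      have h: "h > 0" "h < d" "h < s" using d s0 by (auto simp: h_def)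
      show False using d(2)[OF h(1,2)] below[OF a, of "s - h"] touch h s by auto
    qed
    have "q * \<mu> * \<psi> a \<le> q * (B + A * \<psi> a)" using up low by (simp add: algebra_simps)
    then have "\<mu> * \<psi> a \<le> B + A * \<psi> a" using q by (simp add: mult.assoc)
    moreover have "B \<le> \<bar>B\<bar> * \<psi> a" using mult_left_mono[OF \<psi>(2)[of a], of "\<bar>B\<bar>"] by simp
    moreover have "A * \<psi> a \<le> \<bar>A\<bar> * \<psi> a" using \<psi>pos[of a] by (intro mult_right_mono) auto
    ultimately show False using \<psi>(2)[of a] by (simp add: \<mu>_def algebra_simps)
  next
    case 2
    obtain D where D: "((\<lambda>y. w y s) has_derivative D) (at a within closure \<Omega>)"
      "D (\<nu> a) \<le> M * (LINT y:\<Omega>|lborel. max 0 (w y s))"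
      using bdry[OF 2 s0 s(2)] by blast
    have n: "unit_outward_normal_at \<Omega> a (\<nu> a)" using normal 2 by blast
    have wc: "continuous_on (closure \<Omega>) (\<lambda>y. w y s)"
    proof -
      have "continuous_on (closure \<Omega>) (\<lambda>y. (\<lambda>(x, t). w x t) (y, s))"
        by (rule continuous_on_compose2[OF cont]) (use s in \<open>auto intro!: continuous_intros\<close>)
      then show ?thesis by simp
    qed
    have "(LINT y:\<Omega>|lborel. max 0 (w y s)) \<le> (LINT y:\<Omega>|lborel. 3 * q)"
    proof (rule set_integral_mono)
      show "set_integrable lborel \<Omega> (\<lambda>y. max 0 (w y s))" "set_integrable lborel \<Omega> (\<lambda>y. 3 * q)"
        by (intro set_integrable_continuous_closure \<Omega> continuous_intros wc)+
      fix y assume "y \<in> \<Omega>"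
      then have "y \<in> closure \<Omega>" using closure_subset by blast
      from below[OF this s] have "w y s \<le> q * \<psi> y" by (simp add: q_def)
      also have "\<dots> \<le> q * 3" using \<psi>(3) q by (intro mult_left_mono) auto
      finally show "max 0 (w y s) \<le> 3 * q" using q by simp
    qed
    also have "\<dots> = 3 * q * measure lborel \<Omega>"
      using \<Omega> emeasure_bounded_finite[OF \<Omega>(2)] by (subst set_integral_const) auto
    finally have "M * (LINT y:\<Omega>|lborel. max 0 (w y s)) \<le> M * (3 * q * measure lborel \<Omega>)"
      using M by (rule mult_left_mono)
    also have "\<dots> < q * N" using q by (simp add: N_def algebra_simps)
    finally have Dlt: "D (\<nu> a) < q * N" using D(2) by linarith
    have E: "(\<psi> has_derivative (\<lambda>h. gradient UNIV \<psi> a \<bullet> h)) (at a within closure \<Omega>)"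
      by (rule has_derivative_at_withinI[OF has_derivative_gradient[OF open_UNIV UNIV_I
            Ck_on_2_differentiable[OF \<psi>(1)]]])
    have G: "((\<lambda>y. w y s - q * \<psi> y) has_derivative (\<lambda>h. D h - q * (gradient UNIV \<psi> a \<bullet> h)))
        (at a within closure \<Omega>)"
      by (intro has_derivative_diff has_derivative_mult_right D E)
    \<comment> \<open>The difference of \<open>w\<close> and the barrier vanishes at \<open>a\<close>; it would be positive on a segment into \<open>\<Omega>\<close>.\<close>
    define d where "d = - \<nu> a"
    obtain U \<phi> where \<phi>: "local_defining_function \<Omega> a U \<phi>"
      "\<nu> a = gradient U \<phi> a /\<^sub>R norm (gradient U \<phi> a)"
      using n unfolding unit_outward_normal_at_def by blast
    note L = local_defining_functionD[OF \<phi>(1)]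
    have "gradient U \<phi> a \<bullet> d < 0"
      using L(2,5) by (simp add: d_def \<phi>(2) mult_pos_pos)
    then obtain e where e: "e > 0" "\<And>r. 0 < r \<Longrightarrow> r < e \<Longrightarrow> a + r *\<^sub>R d \<in> \<Omega>"
      using inward_steps[OF \<phi>(1) L(2) 2] by blast
    define g where "g r = w (a + r *\<^sub>R d) s - q * \<psi> (a + r *\<^sub>R d)" for r
    define G' where "G' = D d - q * (gradient UNIV \<psi> a \<bullet> d)"
    have seg: "(\<lambda>r. a + r *\<^sub>R d) ` {0..e/2} \<subseteq> closure \<Omega>"
    proof
      fix y assume "y \<in> (\<lambda>r. a + r *\<^sub>R d) ` {0..e/2}"
      then obtain r where r: "y = a + r *\<^sub>R d" "0 \<le> r" "r \<le> e / 2"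
        unfolding image_iff Bex_def atLeastAtMost_iff by blast
      show "y \<in> closure \<Omega>"
      proof (cases "r = 0")
        case True then show ?thesis using r a by simp
      next
        case False
        then have "y \<in> \<Omega>" using e r by auto
        then show ?thesis using closure_subset by blast
      qed
    qed
    have "((\<lambda>r. a + r *\<^sub>R d) has_derivative (\<lambda>h. h *\<^sub>R d)) (at 0 within {0..e/2})"
      by (auto intro!: derivative_eq_intros)
    from has_derivative_in_compose[OF this, of "\<lambda>y. w y s - q * \<psi> y"
        "\<lambda>h. D h - q * (gradient UNIV \<psi> a \<bullet> h)"]
    have "(g has_derivative (\<lambda>h. D (h *\<^sub>R d) - q * (gradient UNIV \<psi> a \<bullet> (h *\<^sub>R d)))) (at 0 within {0..e/2})"
      using has_derivative_subset[OF G seg] by (simp add: g_def[abs_def])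
    moreover have "D (h *\<^sub>R d) - q * (gradient UNIV \<psi> a \<bullet> (h *\<^sub>R d)) = G' * h" for h
      using linear_cmul[OF has_derivative_linear[OF D(1)]] by (simp add: G'_def algebra_simps)
    ultimately have gd: "(g has_real_derivative G') (at 0 within {0..e/2})"
      by (simp add: has_field_derivative_def)
    have "D d = - D (\<nu> a)"
      unfolding d_def using linear_neg[OF has_derivative_linear[OF D(1)]] by simp
    then have "G' = q * (gradient UNIV \<psi> a \<bullet> \<nu> a) - D (\<nu> a)"
      by (simp add: G'_def d_def)
    moreover have "q * N \<le> q * (gradient UNIV \<psi> a \<bullet> \<nu> a)"
      using \<psi>(4)[OF 2 n] q by simp
    ultimately have "G' > 0" using Dlt by linarith
    from has_real_derivative_pos_inc_right[OF gd this] obtain b where b: "b > 0"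
      "\<And>h. h > 0 \<Longrightarrow> 0 + h \<in> {0..e/2} \<Longrightarrow> h < b \<Longrightarrow> g 0 < g (0 + h)" by auto
    define r where "r = min b e / 2"
    have r: "r > 0" "r < b" "r \<le> e / 2" using b e by (auto simp: r_def)
    have "g 0 < g r" using b(2)[of r] r by auto
    moreover have "a + r *\<^sub>R d \<in> closure \<Omega>"
      using subsetD[OF seg imageI[of r]] r by simp
    from below[OF this s] have "g r \<le> 0" by (simp add: g_def q_def)
    moreover have "g 0 = 0" using touch by (simp add: g_def q_def)
    ultimately show False by linarith
  qed
qed

section \<open>Comparison and uniqueness\<close>

text \<open>
  A mean value estimate: the derivative \<open>q * z powr (q - 1)\<close> for \<open>z\<close> between \<open>\<delta>\<close> and \<open>R\<close> is largest at \<open>R\<close> if \<open>q \<ge> 1\<close> and at \<open>\<delta>\<close> if \<open>q < 1\<close>.  The positive part on the right makes the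
  bound suit a one-sided comparison, because the power is increasing.
\<close>

lemma powr_diff_le:
  fixes q \<delta> R :: real
  assumes q: "q > 0" and \<delta>: "\<delta> \<ge> 0" and R: "R > 0" and either: "q \<ge> 1 \<or> \<delta> > 0"
  obtains L where "L \<ge> 0"
    "\<And>a b. \<delta> \<le> b \<Longrightarrow> \<delta> \<le> a \<Longrightarrow> a \<le> R \<Longrightarrow> a powr q - b powr q \<le> L * max 0 (a - b)"
proof -
  define L where "L = q * (if q \<ge> 1 then R powr (q - 1) else \<delta> powr (q - 1))"
  have L: "L \<ge> 0" using q by (simp add: L_def)
  have "a powr q - b powr q \<le> L * max 0 (a - b)" if ab: "\<delta> \<le> b" "\<delta> \<le> a" "a \<le> R" for a b
  proof (cases "a \<le> b")
    case True
    then have "a powr q \<le> b powr q" using ab \<delta> q by (intro powr_mono2) auto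
    then show ?thesis using True by simp
  next
    case False
    then have lt: "b < a" by simp
    have "\<exists>l z. b < z \<and> z < a \<and> ((\<lambda>s. s powr q) has_real_derivative l) (at z) \<and>
        a powr q - b powr q = (a - b) * l"
    proof (rule MVT[OF lt])
      show "continuous_on {b..a} (\<lambda>s. s powr q)"
        using ab \<delta> q by (intro continuous_on_powr') (auto intro!: continuous_intros)
      show "(\<lambda>s. s powr q) differentiable (at z)" if "b < z" "z < a" for z
      proof -
        have "z > 0" using that ab \<delta> by linarith
        from has_real_derivative_powr[OF this] show ?thesis
          unfolding real_differentiable_def by blast
      qed
    qed
    then obtain l z where z: "b < z" "z < a" "((\<lambda>s. s powr q) has_real_derivative l) (at z)"
      "a powr q - b powr q = (a - b) * l" by blast
    have z0: "z > 0" using z ab \<delta> by linarith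
    have "l = q * z powr (q - 1)"
      using DERIV_unique[OF z(3) has_real_derivative_powr[OF z0]] .
    also have "\<dots> \<le> L"
    proof (cases "q \<ge> 1")
      case True
      then have "z powr (q - 1) \<le> R powr (q - 1)" using z z0 ab by (intro powr_mono2) auto
      then show ?thesis using True q by (simp add: L_def)
    next
      case False
      then have "z powr (q - 1) \<le> \<delta> powr (q - 1)"
        using either z ab by (intro powr_mono2') auto
      then show ?thesis using False q by (simp add: L_def)
    qed
    finally have "(a - b) * l \<le> (a - b) * L" using lt by (intro mult_left_mono) auto
    then show ?thesis using z(4) lt by (simp add: mult.commute)
  qed
  then show ?thesis using that L by blast
qed

lemma closed_cylinder_eq:
  assumes "open \<Omega>" "T > 0"
  shows "cylinder \<Omega> T \<union> parabolic_boundary \<Omega> T = closure \<Omega> \<times> {0..<T}"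
proof -
  have "closure \<Omega> = \<Omega> \<union> frontier \<Omega>"
    using assms closure_subset by (auto simp: frontier_def interior_open)
  then show ?thesis
    using assms by (auto simp: cylinder_def parabolic_boundary_def lateral_boundary_def)
qed

lemma locally_hoelder_bounded:
  assumes f: "locally_hoelder_on \<alpha> f S" and K: "compact K" "K \<subseteq> S" and \<alpha>: "\<alpha> \<ge> 0"
  obtains B where "B \<ge> 0" "\<And>z. z \<in> K \<Longrightarrow> f z \<le> B"
proof (cases "K = {}")
  case False
  then obtain z0 where z0: "z0 \<in> K" by blast
  have "\<exists>C. \<forall>z\<in>K. \<forall>w\<in>K. \<bar>f z - f w\<bar> \<le> C * dist z w powr \<alpha>"
    using f K by (simp add: locally_hoelder_on_def)
  then obtain C where C: "\<And>z w. z \<in> K \<Longrightarrow> w \<in> K \<Longrightarrow> \<bar>f z - f w\<bar> \<le> C * dist z w powr \<alpha>"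
    by metis
  have "f z \<le> \<bar>f z0\<bar> + \<bar>C\<bar> * diameter K powr \<alpha>" if z: "z \<in> K" for z
  proof -
    have "C * dist z z0 powr \<alpha> \<le> \<bar>C\<bar> * dist z z0 powr \<alpha>" by (intro mult_right_mono) auto
    also have "\<dots> \<le> \<bar>C\<bar> * diameter K powr \<alpha>"
      using diameter_bounded_bound[OF compact_imp_bounded[OF K(1)] z z0] \<alpha>
      by (intro mult_left_mono powr_mono2) auto
    finally show ?thesis using C[OF z z0] by linarith
  qed
  then show ?thesis using that[of "\<bar>f z0\<bar> + \<bar>C\<bar> * diameter K powr \<alpha>"] by simp
qed (use that[of 0] in auto)

lemma admissibleD:
  assumes u: "nonneg_admissible \<Omega> T u" and \<Omega>: "open \<Omega>" and T: "T > 0"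
  shows "continuous_on (closure \<Omega> \<times> {0..<T}) (\<lambda>(x, t). u x t)"
    and "x \<in> closure \<Omega> \<Longrightarrow> 0 \<le> t \<Longrightarrow> t < T \<Longrightarrow> 0 \<le> u x t"
    and "0 \<le> t \<Longrightarrow> t < T \<Longrightarrow> continuous_on (closure \<Omega>) (\<lambda>x. u x t)"
    and "0 < t \<Longrightarrow> t < T \<Longrightarrow> Ck_on 2 (\<lambda>x. u x t) \<Omega>"
    and "x \<in> \<Omega> \<Longrightarrow> 0 < t \<Longrightarrow> t < T \<Longrightarrow> (u x has_real_derivative deriv (u x) t) (at t)"
    and "x \<in> closure \<Omega> \<Longrightarrow> 0 \<le> t \<Longrightarrow> t < T \<Longrightarrow>
      ((\<lambda>y. u y t) has_derivative frechet_derivative (\<lambda>y. u y t) (at x within closure \<Omega>))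
        (at x within closure \<Omega>)"
proof -
  note cyl = closed_cylinder_eq[OF \<Omega> T]
  show c: "continuous_on (closure \<Omega> \<times> {0..<T}) (\<lambda>(x, t). u x t)"
    using u unfolding nonneg_admissible_def C10_closed_cylinder_def cyl by blast
  show "0 \<le> u x t" if "x \<in> closure \<Omega>" "0 \<le> t" "t < T"
    using u that unfolding nonneg_admissible_def cyl by auto
  show "continuous_on (closure \<Omega>) (\<lambda>x. u x t)" if "0 \<le> t" "t < T"
  proof -
    have "continuous_on (closure \<Omega>) (\<lambda>y. (\<lambda>(x, t). u x t) (y, t))"
      by (rule continuous_on_compose2[OF c]) (use that in \<open>auto intro!: continuous_intros\<close>)
    then show ?thesis by simp
  qed
  show "Ck_on 2 (\<lambda>x. u x t) \<Omega>" if "0 < t" "t < T"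
    using u that unfolding nonneg_admissible_def C21_cylinder_def by auto
  show "(u x has_real_derivative deriv (u x) t) (at t)" if "x \<in> \<Omega>" "0 < t" "t < T"
  proof -
    have "u x differentiable_on {0<..<T}"
      using u that unfolding nonneg_admissible_def C21_cylinder_def by blast
    then have "u x differentiable (at t)"
      using that by (simp add: differentiable_on_eq_differentiable_at)
    then show ?thesis
      by (simp add: real_differentiable_def) (metis DERIV_imp_deriv)
  qed
  show "((\<lambda>y. u y t) has_derivative frechet_derivative (\<lambda>y. u y t) (at x within closure \<Omega>))
        (at x within closure \<Omega>)" if "x \<in> closure \<Omega>" "0 \<le> t" "t < T"
    using u that unfolding nonneg_admissible_def C10_closed_cylinder_def
    by (auto simp: differentiable_on_def frechet_derivative_works[symmetric])
qed

text \<open>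
  The constant \<open>\<delta>\<close> satisfies the heat equation with zero flux, and a supersolution has a nonnegative
  reaction term and a nonnegative flux.
\<close>

lemma supersolution_ge_initial_bound:
  fixes \<delta> :: real
  assumes dom: "smooth_bounded_domain \<Omega>" and T: "T > 0"
    and normal: "\<forall>x\<in>frontier \<Omega>. unit_outward_normal_at \<Omega> x (\<nu> x)"
    and c_nonneg: "\<forall>x\<in>closure \<Omega>. \<forall>t\<ge>0. c x t \<ge> 0"
    and k_nonneg: "\<forall>x\<in>frontier \<Omega>. \<forall>y\<in>closure \<Omega>. \<forall>t\<ge>0. k x y t \<ge> 0"
    and v: "supersolution \<Omega> \<nu> c k p l u\<^sub>0 T v"
    and \<delta>: "\<And>x. x \<in> \<Omega> \<Longrightarrow> \<delta> \<le> u\<^sub>0 x"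
    and x: "x \<in> closure \<Omega>" and t: "0 \<le> t" "t < T"
  shows "\<delta> \<le> v x t"
proof -
  have \<Omega>: "open \<Omega>" "bounded \<Omega>" using dom by (auto simp: smooth_bounded_domain_def)
  have adm: "nonneg_admissible \<Omega> T v" using v by (simp add: supersolution_def)
  note V = admissibleD[OF adm \<Omega>(1) T]
  have "\<delta> - v x t \<le> 0"
  proof (rule parabolic_comparison[OF dom normal, of 0 t "\<lambda>x t. \<delta> - v x t" 0])
    have "continuous_on (closure \<Omega> \<times> {0..t}) (\<lambda>(x, t). v x t)"
      by (rule continuous_on_subset[OF V(1)]) (use t in auto)
    then show "continuous_on (closure \<Omega> \<times> {0..t}) (\<lambda>(x, t). \<delta> - v x t)"
      unfolding split_beta' by (intro continuous_intros)
    fix y assume y: "y \<in> closure \<Omega>"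
    have "\<delta> \<le> v z 0" if "z \<in> \<Omega>" for z
      using \<delta>[OF that] v that unfolding supersolution_def by force
    then show "\<delta> - v y 0 \<le> 0"
      using continuous_ge_on_closure[OF V(3)[of 0] y] T by simp
  next
    fix s assume s: "0 < s" "s \<le> t"
    then have sT: "s < T" using t by simp
    note Cs = V(4)[OF s(1) sT]
    have Cc: "Ck_on 2 (\<lambda>y. \<delta>) \<Omega>" using \<Omega>(1) by (rule Ck_on_const)
    show "Ck_on 2 (\<lambda>y. \<delta> - v y s) \<Omega>"
      using Ck_on_add_scaled[OF \<Omega>(1) Cc Cs, of "-1"] by simp
    fix y
    {
      assume y: "y \<in> \<Omega>"
      have ycl: "y \<in> closure \<Omega>" using y closure_subset by blast
      have "laplacian \<Omega> (\<lambda>y. \<delta>) y = 0"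
      proof -
        have d: "partial_deriv \<Omega> b (\<lambda>y. a) z = 0" if "z \<in> \<Omega>" for b a z
          using that \<Omega> by (intro partial_deriv_eq) auto
        have "partial_deriv \<Omega> b (partial_deriv \<Omega> b (\<lambda>y. \<delta>)) y = 0" for b
          using partial_deriv_cong[of y \<Omega> "partial_deriv \<Omega> b (\<lambda>y. \<delta>)" "\<lambda>y. 0" b] d y by simp
        then show ?thesis by (simp add: laplacian_def)
      qed
      then have lap: "laplacian \<Omega> (\<lambda>y. \<delta> - v y s) y = - laplacian \<Omega> (\<lambda>y. v y s) y"
        using laplacian_add_scaled[OF \<Omega>(1) y Cc Cs, of "-1"] by simp
      have "deriv (v y) s \<ge> laplacian \<Omega> (\<lambda>y. v y s) y + c y s * v y s powr p"
        using v y s sT unfolding supersolution_def cylinder_def by auto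
      moreover have "c y s * v y s powr p \<ge> 0" using c_nonneg ycl s by simp
      moreover have "((\<lambda>t. \<delta> - v y t) has_real_derivative - deriv (v y) s) (at s)"
        using V(5)[OF y s(1) sT] by (auto intro!: derivative_eq_intros)
      ultimately show "\<exists>D. ((\<lambda>t. \<delta> - v y t) has_real_derivative D) (at s) \<and>
          D \<le> laplacian \<Omega> (\<lambda>y. \<delta> - v y s) y + 0 * (\<delta> - v y s)"
        using lap by (intro exI[of _ "- deriv (v y) s"]) auto
    }
    {
      assume y: "y \<in> frontier \<Omega>"
      have ycl: "y \<in> closure \<Omega>" using y by (simp add: frontier_def)
      have "(LINT z:\<Omega>|lborel. k y z s * v z s powr l) \<ge> 0"
        using k_nonneg y s closure_subset[of \<Omega>] unfolding set_lebesgue_integral_def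
        by (intro Bochner_Integration.integral_nonneg) (auto simp: indicator_def)
      moreover have "normal_deriv \<Omega> \<nu> (\<lambda>y. v y s) y \<ge> (LINT z:\<Omega>|lborel. k y z s * v z s powr l)"
        using v y s sT unfolding supersolution_def lateral_boundary_def by auto
      moreover have "((\<lambda>y. \<delta> - v y s) has_derivative
          (\<lambda>h. 0 - frechet_derivative (\<lambda>y. v y s) (at y within closure \<Omega>) h)) (at y within closure \<Omega>)"
        using ycl s sT by (intro has_derivative_diff has_derivative_const V(6)) auto
      ultimately show "\<exists>D. ((\<lambda>y. \<delta> - v y s) has_derivative D) (at y within closure \<Omega>) \<and>
          D (\<nu> y) \<le> 0 * (LINT y:\<Omega>|lborel. max 0 (\<delta> - v y s))"
        by (intro exI[of _ "\<lambda>h. 0 - frechet_derivative (\<lambda>y. v y s) (at y within closure \<Omega>) h"])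
          (auto simp: normal_deriv_def)
    }
  qed (use x t in auto)
  then show ?thesis by simp
qed

text \<open>
  Where \<open>u > v\<close>, the Lipschitz bounds turn the differences of the powers into multiples of \<open>u - v\<close>;
  in the flux, monotonicity of the power allows the points with \<open>u \<le> v\<close> to be ignored, because \<open>k\<close> is
  nonnegative.  What remains is an instance of the maximum principle on \<open>[0, t]\<close>, where \<open>u\<close>, \<open>c\<close> and
  \<open>k\<close> are bounded by compactness.
\<close>

lemma subsolution_le_supersolution:
  fixes \<delta> :: real
  assumes p: "p > 0" and l: "l > 0" and T: "T > 0"
    and dom: "smooth_bounded_domain \<Omega>"
    and normal: "\<forall>x\<in>frontier \<Omega>. unit_outward_normal_at \<Omega> x (\<nu> x)"
    and alpha: "0 < \<alpha>"
    and c_hoelder: "locally_hoelder_on \<alpha> (\<lambda>(x, t). c x t) (closure \<Omega> \<times> {0..})"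
    and c_nonneg: "\<forall>x\<in>closure \<Omega>. \<forall>t\<ge>0. c x t \<ge> 0"
    and k_cont: "continuous_on (frontier \<Omega> \<times> closure \<Omega> \<times> {0..}) (\<lambda>(x, y, t). k x y t)"
    and k_nonneg: "\<forall>x\<in>frontier \<Omega>. \<forall>y\<in>closure \<Omega>. \<forall>t\<ge>0. k x y t \<ge> 0"
    and u: "subsolution \<Omega> \<nu> c k p l u\<^sub>0 T u"
    and v: "supersolution \<Omega> \<nu> c k p l u\<^sub>0 T v"
    and \<delta>: "0 \<le> \<delta>" "min p l \<ge> 1 \<or> \<delta> > 0"
    and u\<delta>: "\<And>x t. x \<in> closure \<Omega> \<Longrightarrow> 0 \<le> t \<Longrightarrow> t < T \<Longrightarrow> \<delta> \<le> u x t"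
    and v\<delta>: "\<And>x t. x \<in> closure \<Omega> \<Longrightarrow> 0 \<le> t \<Longrightarrow> t < T \<Longrightarrow> \<delta> \<le> v x t"
    and x: "x \<in> closure \<Omega>" and t: "0 \<le> t" "t < T"
  shows "u x t \<le> v x t"
proof -
  have \<Omega>: "open \<Omega>" "bounded \<Omega>" using dom by (auto simp: smooth_bounded_domain_def)
  have clc: "compact (closure \<Omega>)" "compact (frontier \<Omega>)"
    using \<Omega> by (auto simp: compact_closure compact_frontier_bounded)
  have adm: "nonneg_admissible \<Omega> T u" "nonneg_admissible \<Omega> T v"
    using u v by (auto simp: supersolution_def subsolution_def)
  note U = admissibleD[OF adm(1) \<Omega>(1) T] and V = admissibleD[OF adm(2) \<Omega>(1) T]
  have cont: "continuous_on (closure \<Omega> \<times> {0..t}) (\<lambda>(x, t). u x t)"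
    "continuous_on (closure \<Omega> \<times> {0..t}) (\<lambda>(x, t). v x t)"
    by (rule continuous_on_subset[OF U(1)] continuous_on_subset[OF V(1)], use t in auto)+
  have cyl: "compact (closure \<Omega> \<times> {0..t})" using clc by (intro compact_Times) auto
  obtain R where R: "R > 0" and uR: "\<And>y s. y \<in> closure \<Omega> \<Longrightarrow> 0 \<le> s \<Longrightarrow> s \<le> t \<Longrightarrow> u y s \<le> R"
  proof -
    have "bounded ((\<lambda>(x, t). u x t) ` (closure \<Omega> \<times> {0..t}))"
      by (intro compact_imp_bounded compact_continuous_image cont(1) cyl)
    then obtain R where R: "R > 0" "\<forall>z\<in>(\<lambda>(x, t). u x t) ` (closure \<Omega> \<times> {0..t}). norm z \<le> R"
      unfolding bounded_pos by blast
    have "u y s \<le> R" if "y \<in> closure \<Omega>" "0 \<le> s" "s \<le> t" for y s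
    proof -
      have "u y s \<in> (\<lambda>(x, t). u x t) ` (closure \<Omega> \<times> {0..t})" using that by force
      from bspec[OF R(2) this] show ?thesis by (simp add: abs_le_iff)
    qed
    then show ?thesis using that R(1) by blast
  qed
  obtain Lp where Lp: "Lp \<ge> 0" "\<And>a b. \<delta> \<le> b \<Longrightarrow> \<delta> \<le> a \<Longrightarrow> a \<le> R \<Longrightarrow>
      a powr p - b powr p \<le> Lp * max 0 (a - b)"
    by (rule powr_diff_le[OF p \<delta>(1) R]) (use \<delta>(2) in auto)
  obtain Ll where Ll: "Ll \<ge> 0" "\<And>a b. \<delta> \<le> b \<Longrightarrow> \<delta> \<le> a \<Longrightarrow> a \<le> R \<Longrightarrow>
      a powr l - b powr l \<le> Ll * max 0 (a - b)"
    by (rule powr_diff_le[OF l \<delta>(1) R]) (use \<delta>(2) in auto)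
  obtain C where C: "C \<ge> 0" "\<And>y s. y \<in> closure \<Omega> \<Longrightarrow> 0 \<le> s \<Longrightarrow> s \<le> t \<Longrightarrow> c y s \<le> C"
  proof (rule locally_hoelder_bounded[OF c_hoelder cyl])
    fix B assume B: "0 \<le> B" "\<And>z. z \<in> closure \<Omega> \<times> {0..t} \<Longrightarrow> (case z of (x, t) \<Rightarrow> c x t) \<le> B"
      and *: "\<And>C. 0 \<le> C \<Longrightarrow> (\<And>y s. y \<in> closure \<Omega> \<Longrightarrow> 0 \<le> s \<Longrightarrow> s \<le> t \<Longrightarrow> c y s \<le> C) \<Longrightarrow> thesis"
    show thesis by (rule *[OF B(1)]) (use B(2) in force)
  qed (use alpha in auto)
  obtain K where K: "K \<ge> 0"
    "\<And>y z s. y \<in> frontier \<Omega> \<Longrightarrow> z \<in> closure \<Omega> \<Longrightarrow> 0 \<le> s \<Longrightarrow> s \<le> t \<Longrightarrow> k y z s \<le> K"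
  proof -
    have "continuous_on (frontier \<Omega> \<times> closure \<Omega> \<times> {0..t}) (\<lambda>(x, y, t). k x y t)"
      by (rule continuous_on_subset[OF k_cont]) auto
    then have "bounded ((\<lambda>(x, y, t). k x y t) ` (frontier \<Omega> \<times> closure \<Omega> \<times> {0..t}))"
      using clc cyl by (intro compact_imp_bounded compact_continuous_image compact_Times) auto
    then obtain K where K: "K > 0"
      "\<forall>z\<in>(\<lambda>(x, y, t). k x y t) ` (frontier \<Omega> \<times> closure \<Omega> \<times> {0..t}). norm z \<le> K"
      unfolding bounded_pos by blast
    have "k y z s \<le> K" if "y \<in> frontier \<Omega>" "z \<in> closure \<Omega>" "0 \<le> s" "s \<le> t" for y z s
    proof -
      have "k y z s \<in> (\<lambda>(x, y, t). k x y t) ` (frontier \<Omega> \<times> closure \<Omega> \<times> {0..t})"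
        using that by force
      from bspec[OF K(2) this] show ?thesis by (simp add: abs_le_iff)
    qed
    then show ?thesis using that[of K] K(1) by simp
  qed
  have "u x t - v x t \<le> 0"
  proof (rule parabolic_comparison[OF dom normal, of "K * Ll" t "\<lambda>x t. u x t - v x t" "C * Lp"])
    show "0 \<le> K * Ll" using K Ll by simp
    show "continuous_on (closure \<Omega> \<times> {0..t}) (\<lambda>(x, t). u x t - v x t)"
      using cont unfolding split_beta' by (intro continuous_intros)
    fix y assume y: "y \<in> closure \<Omega>"
    have "u z 0 - v z 0 \<le> 0" if "z \<in> \<Omega>" for z
      using u v that unfolding supersolution_def subsolution_def by force
    then show "u y 0 - v y 0 \<le> 0"
      using continuous_le_on_closure[OF continuous_on_diff[OF U(3)[of 0] V(3)[of 0]] y, of 0] T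
      by simp
  next
    fix s assume s: "0 < s" "s \<le> t"
    then have sT: "s < T" using t by simp
    note Cu = U(4)[OF s(1) sT] and Cv = V(4)[OF s(1) sT]
    show "Ck_on 2 (\<lambda>y. u y s - v y s) \<Omega>"
      using Ck_on_add_scaled[OF \<Omega>(1) Cu Cv, of "-1"] by simp
    have bd: "\<delta> \<le> v z s" "\<delta> \<le> u z s" "u z s \<le> R" if "z \<in> closure \<Omega>" for z
      using u\<delta>[OF that] v\<delta>[OF that] uR[OF that] s sT by auto
    fix y
    {
      assume y: "y \<in> \<Omega>" and pos: "0 < u y s - v y s"
      have ycl: "y \<in> closure \<Omega>" using y closure_subset by blast
      have lap: "laplacian \<Omega> (\<lambda>y. u y s - v y s) y = laplacian \<Omega> (\<lambda>y. u y s) y - laplacian \<Omega> (\<lambda>y. v y s) y"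
        using laplacian_add_scaled[OF \<Omega>(1) y Cu Cv, of "-1"] by simp
      have "deriv (u y) s \<le> laplacian \<Omega> (\<lambda>y. u y s) y + c y s * u y s powr p"
        using u y s sT unfolding subsolution_def cylinder_def by auto
      moreover have "deriv (v y) s \<ge> laplacian \<Omega> (\<lambda>y. v y s) y + c y s * v y s powr p"
        using v y s sT unfolding supersolution_def cylinder_def by auto
      moreover have "c y s * u y s powr p - c y s * v y s powr p \<le> C * Lp * (u y s - v y s)"
      proof -
        have "c y s * (u y s powr p - v y s powr p) \<le> c y s * (Lp * (u y s - v y s))"
          using Lp(2)[OF bd[OF ycl]] pos c_nonneg ycl s
          by (intro mult_left_mono) auto
        also have "\<dots> \<le> C * (Lp * (u y s - v y s))"
          using C(2)[OF ycl] s Lp(1) pos by (intro mult_right_mono) auto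
        finally show ?thesis by (simp add: algebra_simps)
      qed
      moreover have "((\<lambda>t. u y t - v y t) has_real_derivative deriv (u y) s - deriv (v y) s) (at s)"
        by (intro DERIV_diff U(5) V(5) y s(1) sT)
      ultimately show "\<exists>D. ((\<lambda>t. u y t - v y t) has_real_derivative D) (at s) \<and>
          D \<le> laplacian \<Omega> (\<lambda>y. u y s - v y s) y + C * Lp * (u y s - v y s)"
        using lap by (intro exI[of _ "deriv (u y) s - deriv (v y) s"]) auto
    }
    {
      assume y: "y \<in> frontier \<Omega>"
      have ycl: "y \<in> closure \<Omega>" using y by (simp add: frontier_def)
      have sc: "0 \<le> s" using s by simp
      note uc = U(3)[OF sc sT] and vc = V(3)[OF sc sT]
      have kc: "continuous_on (closure \<Omega>) (\<lambda>z. k y z s)"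
      proof -
        have "continuous_on (closure \<Omega>) (\<lambda>z. (\<lambda>(x, y, t). k x y t) (y, z, s))"
          by (rule continuous_on_compose2[OF k_cont]) (use y s in \<open>auto intro!: continuous_intros\<close>)
        then show ?thesis by simp
      qed
      have uI: "set_integrable lborel \<Omega> (\<lambda>z. k y z s * u z s powr l)"
        and vI: "set_integrable lborel \<Omega> (\<lambda>z. k y z s * v z s powr l)"
        using U(2)[OF _ sc sT] V(2)[OF _ sc sT] l
        by (auto intro!: set_integrable_continuous_closure \<Omega> continuous_on_mult kc continuous_on_powr'
            uc vc continuous_on_const)
      have mI: "set_integrable lborel \<Omega> (\<lambda>z. max 0 (u z s - v z s))"
        by (intro set_integrable_continuous_closure \<Omega> continuous_intros uc vc)
      have "(LINT z:\<Omega>|lborel. k y z s * u z s powr l) - (LINT z:\<Omega>|lborel. k y z s * v z s powr l)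
          = (LINT z:\<Omega>|lborel. k y z s * u z s powr l - k y z s * v z s powr l)"
        using set_integral_diff(2)[OF uI vI] by simp
      also have "\<dots> \<le> (LINT z:\<Omega>|lborel. K * Ll * max 0 (u z s - v z s))"
      proof (rule set_integral_mono)
        show "set_integrable lborel \<Omega> (\<lambda>z. k y z s * u z s powr l - k y z s * v z s powr l)"
          by (rule set_integral_diff(1)[OF uI vI])
        show "set_integrable lborel \<Omega> (\<lambda>z. K * Ll * max 0 (u z s - v z s))"
          using mI by (rule set_integrable_mult_right[rotated]) 
        fix z assume "z \<in> \<Omega>"
        then have z: "z \<in> closure \<Omega>" using closure_subset by blast
        have "k y z s * (u z s powr l - v z s powr l) \<le> k y z s * (Ll * max 0 (u z s - v z s))"
          using Ll(2)[OF bd[OF z]] k_nonneg y z s by (intro mult_left_mono) auto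
        also have "\<dots> \<le> K * (Ll * max 0 (u z s - v z s))"
          using K(2)[OF y z] s Ll(1) by (intro mult_right_mono) auto
        finally show "k y z s * u z s powr l - k y z s * v z s powr l \<le> K * Ll * max 0 (u z s - v z s)"
          by (simp add: algebra_simps)
      qed
      also have "\<dots> = K * Ll * (LINT z:\<Omega>|lborel. max 0 (u z s - v z s))"
        by (rule set_integral_mult_right)
      finally have int: "(LINT z:\<Omega>|lborel. k y z s * u z s powr l) -
          (LINT z:\<Omega>|lborel. k y z s * v z s powr l) \<le> K * Ll * (LINT z:\<Omega>|lborel. max 0 (u z s - v z s))" .
      have "normal_deriv \<Omega> \<nu> (\<lambda>y. u y s) y \<le> (LINT z:\<Omega>|lborel. k y z s * u z s powr l)"
        using u y s sT unfolding subsolution_def lateral_boundary_def by auto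
      moreover have "normal_deriv \<Omega> \<nu> (\<lambda>y. v y s) y \<ge> (LINT z:\<Omega>|lborel. k y z s * v z s powr l)"
        using v y s sT unfolding supersolution_def lateral_boundary_def by auto
      moreover have "((\<lambda>y. u y s - v y s) has_derivative
          (\<lambda>h. frechet_derivative (\<lambda>y. u y s) (at y within closure \<Omega>) h
             - frechet_derivative (\<lambda>y. v y s) (at y within closure \<Omega>) h)) (at y within closure \<Omega>)"
        by (intro has_derivative_diff U(6) V(6) ycl sc sT)
      ultimately show "\<exists>D. ((\<lambda>y. u y s - v y s) has_derivative D) (at y within closure \<Omega>) \<and>
          D (\<nu> y) \<le> K * Ll * (LINT y:\<Omega>|lborel. max 0 (u y s - v y s))"
        using int
        by (intro exI[of _ "\<lambda>h. frechet_derivative (\<lambda>y. u y s) (at y within closure \<Omega>) h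
             - frechet_derivative (\<lambda>y. v y s) (at y within closure \<Omega>) h"])
          (auto simp: normal_deriv_def)
    }
  qed (use x t in auto)
  then show ?thesis by simp
qed

theorem theorem2p5:
  fixes \<Omega> :: "'a::euclidean_space set"
    and \<nu> :: "'a \<Rightarrow> 'a"
    and c :: "'a \<Rightarrow> real \<Rightarrow> real"
    and k :: "'a \<Rightarrow> 'a \<Rightarrow> real \<Rightarrow> real"
    and u\<^sub>0 :: "'a \<Rightarrow> real"
    and p l \<alpha> T :: real
  assumes p: "p > 0" and l: "l > 0" and T: "T > 0"
    and dom: "smooth_bounded_domain \<Omega>"
    and normal: "\<forall>x\<in>frontier \<Omega>. unit_outward_normal_at \<Omega> x (\<nu> x)"
    and alpha: "0 < \<alpha>" "\<alpha> < 1"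
    and c_hoelder: "locally_hoelder_on \<alpha> (\<lambda>(x, t). c x t) (closure \<Omega> \<times> {0..})"
    and c_nonneg: "\<forall>x\<in>closure \<Omega>. \<forall>t\<ge>0. c x t \<ge> 0"
    and k_cont: "continuous_on (frontier \<Omega> \<times> closure \<Omega> \<times> {0..}) (\<lambda>(x, y, t). k x y t)"
    and k_nonneg: "\<forall>x\<in>frontier \<Omega>. \<forall>y\<in>closure \<Omega>. \<forall>t\<ge>0. k x y t \<ge> 0"
    and u0_C1: "Ck_on 1 u\<^sub>0 (closure \<Omega>)"
    and u0_nonneg: "\<forall>x\<in>\<Omega>. u\<^sub>0 x \<ge> 0"
    and u0_compat: "\<forall>x\<in>frontier \<Omega>.
          normal_deriv \<Omega> \<nu> u\<^sub>0 x = (LINT y:\<Omega>|lborel. k x y 0 * u\<^sub>0 y powr l)"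
    and u0_pos: "min p l < 1 \<Longrightarrow> \<forall>x\<in>closure \<Omega>. u\<^sub>0 x > 0"
    and ex: "\<exists>u. solution \<Omega> \<nu> c k p l u\<^sub>0 T u"
  shows "\<exists>u. solution \<Omega> \<nu> c k p l u\<^sub>0 T u \<and>
           (\<forall>v. solution \<Omega> \<nu> c k p l u\<^sub>0 T v \<longrightarrow>
              (\<forall>(x, t)\<in>cylinder \<Omega> T \<union> parabolic_boundary \<Omega> T. v x t = u x t))"
proof -
  have \<Omega>: "open \<Omega>" "bounded \<Omega>" "\<Omega> \<noteq> {}" using dom by (auto simp: smooth_bounded_domain_def)
  \<comment> \<open>If both exponents are at least \<open>1\<close>, the lower bound \<open>0\<close> suffices.\<close>
  obtain \<delta> where \<delta>: "0 \<le> \<delta>" "min p l \<ge> 1 \<or> \<delta> > 0" "\<And>x. x \<in> \<Omega> \<Longrightarrow> \<delta> \<le> u\<^sub>0 x"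
  proof (cases "min p l < 1")
    case True
    have "continuous_on (closure \<Omega>) u\<^sub>0" using u0_C1 by (rule Ck_on_imp_continuous_on)
    then obtain x0 where "x0 \<in> closure \<Omega>" "\<forall>x\<in>closure \<Omega>. u\<^sub>0 x0 \<le> u\<^sub>0 x"
      using continuous_attains_inf[of "closure \<Omega>" u\<^sub>0] \<Omega> by (auto simp: compact_closure)
    then show ?thesis
      using that[of "u\<^sub>0 x0"] u0_pos[OF True] closure_subset[of \<Omega>] by (auto simp: less_imp_le)
  next
    case False
    then show ?thesis using that[of 0] u0_nonneg by (simp add: not_less)
  qed
  have le: "u x t \<le> v x t"
    if sol: "solution \<Omega> \<nu> c k p l u\<^sub>0 T u" "solution \<Omega> \<nu> c k p l u\<^sub>0 T v"
      and xt: "x \<in> closure \<Omega>" "0 \<le> t" "t < T" for u v x t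
  proof -
    have low: "\<delta> \<le> w y s"
      if w: "solution \<Omega> \<nu> c k p l u\<^sub>0 T w" and y: "y \<in> closure \<Omega>" "0 \<le> s" "s < T" for w y s
    proof -
      have "supersolution \<Omega> \<nu> c k p l u\<^sub>0 T w" using w by (simp add: solution_def)
      from supersolution_ge_initial_bound[OF dom T normal c_nonneg k_nonneg this \<delta>(3) y]
      show ?thesis .
    qed
    show ?thesis
      by (rule subsolution_le_supersolution[OF p l T dom normal alpha(1) c_hoelder c_nonneg k_cont
            k_nonneg _ _ \<delta>(1,2) low[OF sol(1)] low[OF sol(2)] xt])
        (use sol in \<open>auto simp: solution_def\<close>)
  qed
  obtain u where u: "solution \<Omega> \<nu> c k p l u\<^sub>0 T u" using ex by blast
  show ?thesis
    unfolding closed_cylinder_eq[OF \<Omega>(1) T]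
    using u le by (intro exI[of _ u]) (auto intro!: antisym)
qed

end
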